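(* Let $\alpha>0$, let $-\infty<A_1<A_2<+\infty$, let $V:[A_1,A_2]\to\mathbb{R}$ be a smooth function with $V'(A_1)=V'(A_2)=0$, and set $U=V-\alpha^2V''$. Let $\mathbf{u}^0(x,y)=(U(y),0)$, $\mathbf{v}^0(x,y)=(V(y),0)$, $\pi(x,y)=p_0-\frac12V(y)^2+\frac{\alpha^2}{2}(V'(y))^2$ (with $p_0\in\mathbb{R}$ constant) be the corresponding steady state solution of the $\alpha$-Euler equations on $D=\mathbb{R}\times[A_1,A_2]$. Suppose that the linearized stream function equation about this steady state, $$\Delta\widetilde{\psi}_t+V(y)\,\Delta\widetilde{\psi}_x-U''(y)\,\widetilde{\phi}_x=0\ \text{ on } D,\qquad \widetilde{\psi}=(1-\alpha^2\Delta)\widetilde{\phi},$$ with boundary conditions $\nabla\widetilde{\phi}\cdot\mathbf{t}=0$ and $\big((\mathbf{n}\cdot\nabla)(-\nabla^{\perp}\widetilde{\phi})\big)\cdot\mathbf{t}=0$ on $\partial D$, has a nontrivial solution of the form $$\widetilde{\psi}(x,y,t)=\psi(y)e^{ik(x-ct)},\qquad \widetilde{\phi}(x,y,t)=\phi(y)e^{ik(x-ct)},$$ where $k\in\mathbb{R}\setminus\{0\}$, $c=c_r+ic_i\in\mathbb{C}$ with $c_i>0$, and $\phi,\psi:[A_1,A_2]\to\mathbb{C}$ with $\phi\in H^4([A_1,A_2];\mathbb{C})$, $\phi\not\equiv0$. Then $U''(y_s)=0$ for at least one point $y_s\in[A_1,A_2]$.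
   Context: The $\alpha$-Euler equations are $\mathbf{u}_t+(\mathbf{v}\cdot\nabla)\mathbf{u}+(\nabla\mathbf{v})^{\top}\mathbf{u}+\nabla\pi=0$, $(1-\alpha^2\Delta)\mathbf{v}=\mathbf{u}$, $\operatorname{div}\mathbf{u}=\operatorname{div}\mathbf{v}=0$, where $\nabla\mathbf{v}$ is the Jacobi matrix $(\partial v_i/\partial x_j)$, with boundary conditions $\mathbf{v}\cdot\mathbf{n}=0$ and $(\mathbf{n}\cdot\nabla)\mathbf{v}$ parallel to $\mathbf{n}$ on $\partial D$. Notation: $\nabla^{\perp}=(-\partial_y,\partial_x)$; $\mathbf{n}$ is the unit outer normal and $\mathbf{t}=(1,0)$ the unit tangent on the walls $y=A_1$, $y=A_2$. The stream functions $\phi,\psi$ of $\mathbf{v},\mathbf{u}$ satisfy $\mathbf{v}=-\nabla^{\perp}\phi$, $\mathbf{u}=-\nabla^{\perp}\psi$, $\psi=(1-\alpha^2\Delta)\phi$; for the shear steady state $\partial_y\phi^0=V$, $\partial_y\psi^0=U$. The displayed linear equation is the linearization of the stream-function (vorticity) form of the equations about this steady state. *)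

theory Defs
  imports "HOL-Analysis.Analysis"
begin

section \<open>Derivatives on intervals and smooth functions\<close>

text \<open>
  Derivative of a function of one real variable within a set. On a compact interval the
  derivatives at the two end points are the one-sided ones, and values outside are irrelevant.
\<close>

definition deriv_on :: "real set \<Rightarrow> (real \<Rightarrow> 'a::real_normed_vector) \<Rightarrow> real \<Rightarrow> 'a" where
  "deriv_on S f = (\<lambda>y. vector_derivative f (at y within S))"

definition smooth_on :: "real set \<Rightarrow> (real \<Rightarrow> 'a::real_normed_vector) \<Rightarrow> bool" where
  "smooth_on S f \<longleftrightarrow> (\<forall>n. (deriv_on S ^^ n) f differentiable_on S)"

section \<open>Sobolev spaces on a compact interval\<close>

definition test_function :: "real \<Rightarrow> real \<Rightarrow> (real \<Rightarrow> real) \<Rightarrow> bool" where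
  "test_function a b \<eta> \<longleftrightarrow>
     smooth_on UNIV \<eta> \<and> (\<exists>c d. a < c \<and> d < b \<and> (\<forall>y. y \<notin> {c..d} \<longrightarrow> \<eta> y = 0))"

definition square_integrable_on :: "real \<Rightarrow> real \<Rightarrow> (real \<Rightarrow> complex) \<Rightarrow> bool" where
  "square_integrable_on a b f \<longleftrightarrow>
     f \<in> borel_measurable (lebesgue_on {a..b}) \<and>
     integrable (lebesgue_on {a..b}) (\<lambda>y. (cmod (f y))\<^sup>2)"

definition weak_deriv ::
    "real \<Rightarrow> real \<Rightarrow> nat \<Rightarrow> (real \<Rightarrow> complex) \<Rightarrow> (real \<Rightarrow> complex) \<Rightarrow> bool" where
  "weak_deriv a b j f g \<longleftrightarrow>
     (\<forall>\<eta>. test_function a b \<eta> \<longrightarrow>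
        (\<integral>y. (deriv_on UNIV ^^ j) \<eta> y *\<^sub>R f y \<partial>lebesgue_on {a..b}) =
        (- 1) ^ j * (\<integral>y. \<eta> y *\<^sub>R g y \<partial>lebesgue_on {a..b}))"

text \<open>
  Elements of \<open>H\<^sup>m\<close> with \<open>m \<ge> 1\<close> are identified, as usual on an interval, with their continuous
  representative; this is what gives a meaning to boundary values. The representative of an
  element of \<open>H\<^sup>m\<close> is \<open>m - 1\<close> times continuously differentiable up to the boundary, and its derivative of
  order \<open>m\<close> exists in the classical sense almost everywhere and equals the weak one.
\<close>

definition sobolev_H :: "nat \<Rightarrow> real \<Rightarrow> real \<Rightarrow> (real \<Rightarrow> complex) \<Rightarrow> bool" where
  "sobolev_H m a b f \<longleftrightarrow>
     continuous_on {a..b} f \<and>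
     (\<forall>j\<le>m. \<exists>g. square_integrable_on a b g \<and> weak_deriv a b j f g)"

section \<open>Fields on the channel\<close>

text \<open>
  Fields depend on \<open>(x, y, t)\<close>, with \<open>y\<close> ranging over \<open>{a..b}\<close>. They are scalar, or planar
  vector fields with values in \<open>'a \<times> 'a\<close>, where \<open>'a\<close> is \<open>real\<close> or \<open>complex\<close>.
\<close>

type_synonym 'a field = "real \<Rightarrow> real \<Rightarrow> real \<Rightarrow> 'a"

definition dx :: "'a::real_normed_vector field \<Rightarrow> 'a field" where
  "dx f = (\<lambda>x y t. vector_derivative (\<lambda>x'. f x' y t) (at x))"

definition dy :: "real \<Rightarrow> real \<Rightarrow> 'a::real_normed_vector field \<Rightarrow> 'a field" where
  "dy a b f = (\<lambda>x y t. deriv_on {a..b} (\<lambda>y'. f x y' t) y)"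

definition dt :: "'a::real_normed_vector field \<Rightarrow> 'a field" where
  "dt f = (\<lambda>x y t. vector_derivative (\<lambda>t'. f x y t') (at t))"

definition laplacian :: "real \<Rightarrow> real \<Rightarrow> 'a::real_normed_vector field \<Rightarrow> 'a field" where
  "laplacian a b f = (\<lambda>x y t. dx (dx f) x y t + dy a b (dy a b f) x y t)"

definition gradient :: "real \<Rightarrow> real \<Rightarrow> 'a::real_normed_vector field \<Rightarrow> ('a \<times> 'a) field" where
  "gradient a b f = (\<lambda>x y t. (dx f x y t, dy a b f x y t))"

definition grad_perp :: "real \<Rightarrow> real \<Rightarrow> 'a::real_normed_vector field \<Rightarrow> ('a \<times> 'a) field" where
  "grad_perp a b f = (\<lambda>x y t. (- dy a b f x y t, dx f x y t))"

definition divergence :: "real \<Rightarrow> real \<Rightarrow> ('a \<times> 'a) field \<Rightarrow> 'a::real_normed_vector field" where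
  "divergence a b w = (\<lambda>x y t. fst (dx w x y t) + snd (dy a b w x y t))"

text \<open>The bilinear (not sesquilinear) product of a possibly complex vector with a real one.\<close>

definition dot :: "'a \<times> 'a \<Rightarrow> real \<times> real \<Rightarrow> 'a::real_vector" where
  "dot w e = fst e *\<^sub>R fst w + snd e *\<^sub>R snd w"

text \<open>The operator \<open>(e \<cdot> \<nabla>)\<close> for a real vector field \<open>e\<close>.\<close>

definition directional ::
    "real \<Rightarrow> real \<Rightarrow> (real \<times> real) field \<Rightarrow> 'a::real_normed_vector field \<Rightarrow> 'a field" where
  "directional a b e w =
     (\<lambda>x y t. fst (e x y t) *\<^sub>R dx w x y t + snd (e x y t) *\<^sub>R dy a b w x y t)"

text \<open>Outer unit normal and unit tangent; only the values for \<open>y \<in> {a, b}\<close> matter.\<close>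

definition outer_normal :: "real \<Rightarrow> real \<Rightarrow> (real \<times> real) field" where
  "outer_normal a b = (\<lambda>x y t. (0, if y = b then 1 else - 1))"

definition tangent :: "real \<times> real" where
  "tangent = (1, 0)"

definition differentiable_field :: "real \<Rightarrow> real \<Rightarrow> 'a::real_normed_vector field \<Rightarrow> bool" where
  "differentiable_field a b f \<longleftrightarrow>
     (\<lambda>(x, y, t). f x y t) differentiable_on (UNIV \<times> {a..b} \<times> UNIV)"

section \<open>The alpha-Euler equations\<close>

text \<open>
  The pair of inner products is \<open>(\<nabla>v)\<^sup>T u\<close>, since its \<open>j\<close>-th entry is the sum over \<open>i\<close> of
  \<open>(\<partial>\<^sub>j v\<^sub>i) u\<^sub>i\<close>.
\<close>

definition alpha_Euler ::
    "real \<Rightarrow> real \<Rightarrow> real \<Rightarrow> (real \<times> real) field \<Rightarrow> (real \<times> real) field \<Rightarrow> real field \<Rightarrow> bool" where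
  "alpha_Euler \<alpha> a b u v p \<longleftrightarrow>
     differentiable_field a b u \<and> differentiable_field a b v \<and> differentiable_field a b p \<and>
     differentiable_field a b (dx v) \<and> differentiable_field a b (dy a b v) \<and>
     (\<forall>x t. \<forall>y\<in>{a..b}.
        dt u x y t + directional a b v u x y t
          + (dx v x y t \<bullet> u x y t, dy a b v x y t \<bullet> u x y t)
          + gradient a b p x y t = 0 \<and>
        v x y t - \<alpha>\<^sup>2 *\<^sub>R laplacian a b v x y t = u x y t \<and>
        divergence a b u x y t = 0 \<and>
        divergence a b v x y t = 0) \<and>
     (\<forall>x t. \<forall>y\<in>{a, b}.
        dot (v x y t) (outer_normal a b x y t) = 0 \<and>
        (\<exists>s::real. directional a b (outer_normal a b) v x y t = s *\<^sub>R outer_normal a b x y t))"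

section \<open>The linearized stream function equation\<close>

text \<open>
  For a stream function of class \<open>H\<^sup>4\<close> in \<open>y\<close>, the second derivative in \<open>y\<close> of \<open>\<Psi>\<close> exists only
  almost everywhere, so the evolution equation is required almost everywhere on the channel.
  All the other derivatives exist everywhere.
\<close>

definition linearized_stream_solution ::
    "real \<Rightarrow> real \<Rightarrow> real \<Rightarrow> (real \<Rightarrow> real) \<Rightarrow> (real \<Rightarrow> real) \<Rightarrow>
     complex field \<Rightarrow> complex field \<Rightarrow> bool" where
  "linearized_stream_solution \<alpha> a b V U \<Psi> \<Phi> \<longleftrightarrow>
     (\<forall>t. AE (x, y) in lborel. y \<in> {a..b} \<longrightarrow>
        laplacian a b (dt \<Psi>) x y t
          + V y *\<^sub>R laplacian a b (dx \<Psi>) x y t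
          - deriv_on {a..b} (deriv_on {a..b} U) y *\<^sub>R dx \<Phi> x y t = 0) \<and>
     (\<forall>x t. \<forall>y\<in>{a..b}. \<Psi> x y t = \<Phi> x y t - \<alpha>\<^sup>2 *\<^sub>R laplacian a b \<Phi> x y t) \<and>
     (\<forall>x t. \<forall>y\<in>{a, b}.
        dot (gradient a b \<Phi> x y t) tangent = 0 \<and>
        dot (directional a b (outer_normal a b) (\<lambda>x y t. - grad_perp a b \<Phi> x y t) x y t) tangent
          = 0)"

definition normal_mode :: "real \<Rightarrow> complex \<Rightarrow> (real \<Rightarrow> complex) \<Rightarrow> complex field" where
  "normal_mode k c f = (\<lambda>x y t. f y * exp (\<i> * k * (x - c * t)))"

section \<open>Shear flows are steady states\<close>

lemma deriv_on_cong:
  assumes "\<And>y. y \<in> S \<Longrightarrow> f y = g y" "y \<in> S"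
  shows "deriv_on S f y = deriv_on S g y"
proof -
  have "(f has_vector_derivative D) (at y within S) \<longleftrightarrow> (g has_vector_derivative D) (at y within S)" for D
    using assms has_vector_derivative_transform[of y S] by metis
  then show ?thesis
    unfolding deriv_on_def vector_derivative_def by simp
qed

lemma deriv_on_eqI:
  fixes a b :: real
  assumes "a < b" "y \<in> {a..b}" "(f has_vector_derivative D) (at y within {a..b})"
  shows "deriv_on {a..b} f y = D"
  using assms vector_derivative_within_cbox[of a b y f D] by (simp add: deriv_on_def)

lemma has_deriv_on:
  assumes "f differentiable_on S" "y \<in> S"
  shows "(f has_vector_derivative deriv_on S f y) (at y within S)"
  using assms by (simp add: deriv_on_def differentiable_on_def vector_derivative_works)

text \<open>
  Hence the hypothesis \<open>alpha_Euler\<close> on a shear flow is automatically satisfied.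
\<close>

lemma shear_flow_steady:
  fixes \<alpha> A1 A2 p0 :: real and V U :: "real \<Rightarrow> real"
    and u0 v0 :: "real \<Rightarrow> real \<Rightarrow> real \<times> real" and p :: "real \<Rightarrow> real \<Rightarrow> real"
  assumes A: "A1 < A2" and sm: "smooth_on {A1..A2} V"
    and bc: "deriv_on {A1..A2} V A1 = 0" "deriv_on {A1..A2} V A2 = 0"
    and U: "\<forall>y\<in>{A1..A2}. U y = V y - \<alpha>\<^sup>2 * deriv_on {A1..A2} (deriv_on {A1..A2} V) y"
    and u0: "\<forall>x. \<forall>y\<in>{A1..A2}. u0 x y = (U y, 0)"
    and v0: "\<forall>x. \<forall>y\<in>{A1..A2}. v0 x y = (V y, 0)"
    and p: "\<forall>x. \<forall>y\<in>{A1..A2}.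
              p x y = p0 - (V y)\<^sup>2 / 2 + \<alpha>\<^sup>2 / 2 * (deriv_on {A1..A2} V y)\<^sup>2"
  shows "alpha_Euler \<alpha> A1 A2 (\<lambda>x y t. u0 x y) (\<lambda>x y t. v0 x y) (\<lambda>x y t. p x y)"
proof -
  let ?S = "{A1..A2}"
  define V1 where "V1 = deriv_on ?S V"
  define V2 where "V2 = deriv_on ?S V1"
  define U1 where "U1 = deriv_on ?S U"
  have dV: "V differentiable_on ?S" using sm[unfolded smooth_on_def, rule_format, of 0] by simp
  have dV1: "V1 differentiable_on ?S" using sm[unfolded smooth_on_def, rule_format, of 1] by (simp add: V1_def)
  have dV2: "V2 differentiable_on ?S"
    using sm[unfolded smooth_on_def, rule_format, of 2] by (simp add: V1_def V2_def numeral_2_eq_2)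
  have U': "U y = V y - \<alpha>\<^sup>2 * V2 y" if "y \<in> ?S" for y
    using U that by (simp add: V1_def V2_def)
  have "(\<lambda>y. V y - \<alpha>\<^sup>2 * V2 y) differentiable_on ?S"
    by (intro derivative_intros dV dV2)
  then have dU: "U differentiable_on ?S"
    using U' unfolding differentiable_on_def
    by (metis (no_types, lifting) differentiable_transform_within zero_less_one)
  have hV: "(V has_vector_derivative V1 y) (at y within ?S)" if "y \<in> ?S" for y
    using has_deriv_on[OF dV that] by (simp add: V1_def)
  have hV1: "(V1 has_vector_derivative V2 y) (at y within ?S)" if "y \<in> ?S" for y
    using has_deriv_on[OF dV1 that] by (simp add: V2_def)
  have hU: "(U has_vector_derivative U1 y) (at y within ?S)" if "y \<in> ?S" for y
    using has_deriv_on[OF dU that] by (simp add: U1_def)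
  have pairD: "deriv_on ?S (\<lambda>y'. (f y', 0::real)) y = (f' , 0)"
    if "(f has_vector_derivative f') (at y within ?S)" "y \<in> ?S" for f f' y
    by (rule deriv_on_eqI[OF A that(2) has_vector_derivative_Pair[OF that(1)]]) simp
  have dyv: "dy A1 A2 (\<lambda>x y t. v0 x y) x y t = (V1 y, 0)" if "y \<in> ?S" for x y t
    unfolding dy_def
    using deriv_on_cong[of ?S "v0 x" "\<lambda>y. (V y, 0)" y] pairD[OF hV[OF that] that] v0 that by simp
  have dyyv: "dy A1 A2 (dy A1 A2 (\<lambda>x y t. v0 x y)) x y t = (V2 y, 0)" if "y \<in> ?S" for x y t
    unfolding dy_def[of A1 A2 "dy A1 A2 _"]
    using deriv_on_cong[of ?S "\<lambda>y'. dy A1 A2 (\<lambda>x y t. v0 x y) x y' t" "\<lambda>y. (V1 y, 0)" y]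
      pairD[OF hV1[OF that] that] dyv that by simp
  have dyu: "dy A1 A2 (\<lambda>x y t. u0 x y) x y t = (U1 y, 0)" if "y \<in> ?S" for x y t
    unfolding dy_def
    using deriv_on_cong[of ?S "u0 x" "\<lambda>y. (U y, 0)" y] pairD[OF hU[OF that] that] u0 that by simp
  have hp: "((\<lambda>y. p0 - (V y)\<^sup>2 / 2 + \<alpha>\<^sup>2 / 2 * (V1 y)\<^sup>2) has_vector_derivative
            (- V y * V1 y + \<alpha>\<^sup>2 * V1 y * V2 y)) (at y within ?S)" if y: "y \<in> ?S" for y
    using hV[OF y] hV1[OF y]
    unfolding has_real_derivative_iff_has_vector_derivative[symmetric]
    by (auto intro!: derivative_eq_intros)
  have dyp: "dy A1 A2 (\<lambda>x y t. p x y) x y t = - V y * V1 y + \<alpha>\<^sup>2 * V1 y * V2 y" if y: "y \<in> ?S" for x y t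
    using deriv_on_eqI[OF A y hp[OF y]]
      deriv_on_cong[of ?S "p x" "\<lambda>y. p0 - (V y)\<^sup>2 / 2 + \<alpha>\<^sup>2 / 2 * (V1 y)\<^sup>2" y] p y
    by (simp add: dy_def V1_def)
  have dxv: "dx (\<lambda>x y t. v0 x y) x y t = 0" if "y \<in> ?S" for x y t
    using v0 that by (simp add: dx_def)
  have dxxv: "dx (dx (\<lambda>x y t. v0 x y)) x y t = 0" if "y \<in> ?S" for x y t
    using dxv[OF that] by (simp add: dx_def[of "dx _"])
  have dxu: "dx (\<lambda>x y t. u0 x y) x y t = 0" if "y \<in> ?S" for x y t
    using u0 that by (simp add: dx_def)
  have dxp: "dx (\<lambda>x y t. p x y) x y t = 0" if "y \<in> ?S" for x y t
    using p that by (simp add: dx_def)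
  have dtu: "dt (\<lambda>x y t. u0 x y) x y t = 0" for x y t
    by (simp add: dt_def)
  have field: "differentiable_field A1 A2 F"
    if F: "\<And>x y t. y \<in> ?S \<Longrightarrow> F x y t = f y" and f: "f differentiable_on ?S"
    for F :: "'a::real_normed_vector field" and f
  proof -
    let ?T = "UNIV \<times> ?S \<times> (UNIV :: real set) :: (real \<times> real \<times> real) set"
    let ?h = "\<lambda>z::real \<times> real \<times> real. fst (snd z)"
    have im: "?h ` ?T = ?S" by force
    have "?h differentiable_on ?T"
      using has_derivative_fst[OF has_derivative_snd[OF has_derivative_ident]]
      unfolding differentiable_on_def differentiable_def by blast
    moreover have "f differentiable_on ?h ` ?T" using f im by simp
    ultimately have "f \<circ> ?h differentiable_on ?T"
      unfolding o_def by (rule differentiable_on_compose[where g = ?h])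
    moreover have "(f \<circ> ?h) z = (case z of (x, y, t) \<Rightarrow> F x y t)" if "z \<in> ?T" for z
      using F that by auto
    ultimately show ?thesis
      unfolding differentiable_field_def differentiable_on_def
      by (metis (no_types, lifting) differentiable_transform_within zero_less_one)
  qed
  have pair: "(\<lambda>y. (f y, 0::real)) differentiable_on ?S" if "f differentiable_on ?S" for f :: "real \<Rightarrow> real"
    unfolding differentiable_on_def
  proof
    fix y assume "y \<in> ?S"
    with that obtain D where "(f has_derivative D) (at y within ?S)"
      unfolding differentiable_on_def differentiable_def by blast
    from has_derivative_Pair[OF this has_derivative_const]
    show "(\<lambda>y. (f y, 0::real)) differentiable (at y within ?S)"
      unfolding differentiable_def by blast
  qed
  have dp: "(\<lambda>y. p0 - (V y)\<^sup>2 / 2 + \<alpha>\<^sup>2 / 2 * (V1 y)\<^sup>2) differentiable_on ?S"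
    using hp unfolding differentiable_on_def by (blast intro: differentiableI_vector)
  have "differentiable_field A1 A2 (\<lambda>x y t. u0 x y)"
    by (rule field[OF _ pair[OF dU]]) (use u0 in auto)
  moreover have "differentiable_field A1 A2 (\<lambda>x y t. v0 x y)"
    by (rule field[OF _ pair[OF dV]]) (use v0 in auto)
  moreover have "differentiable_field A1 A2 (\<lambda>x y t. p x y)"
    by (rule field[OF _ dp]) (use p in \<open>auto simp: V1_def\<close>)
  moreover have "differentiable_field A1 A2 (dx (\<lambda>x y t. v0 x y))"
    by (rule field[OF _ differentiable_on_const]) (use dxv in auto)
  moreover have "differentiable_field A1 A2 (dy A1 A2 (\<lambda>x y t. v0 x y))"
    by (rule field[OF _ pair[OF dV1]]) (use dyv in auto)
  ultimately show ?thesis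
    unfolding alpha_Euler_def
    using A bc u0 v0 U'
    by (auto simp: directional_def gradient_def laplacian_def divergence_def dot_def outer_normal_def
        dyv dyyv dyu dyp dxv dxxv dxu dxp dtu V1_def[symmetric] zero_prod_def algebra_simps
        intro!: exI[of _ 0])
qed

end

theory Submission
  imports Defs
begin

text \<open>
  Rayleigh's argument. The normal mode satisfies \<open>(V - c) (\<psi>'' - k\<^sup>2 \<psi>) = U'' \<phi>\<close>
  almost everywhere, with \<open>\<phi>\<close> and \<open>\<phi>''\<close> vanishing on the walls. Multiply it by
  \<open>cnj \<phi> / (V - c)\<close> and integrate: as \<open>\<psi> = (1 + \<alpha>\<^sup>2 k\<^sup>2) \<phi> - \<alpha>\<^sup>2 \<phi>''\<close>,
  integration by parts shows that the left-hand side is real, so the imaginary part of the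
  right-hand side, which is the integral of \<open>Im c * U'' \<bar>\<phi>\<bar>\<^sup>2 / \<bar>V - c\<bar>\<^sup>2\<close>, vanishes. If
  \<open>U''\<close> had no zero, its sign would be constant and \<open>\<phi>\<close> would vanish identically.

  The weak derivatives are converted to classical ones by the fundamental lemma of the calculus
  of variations and the almost everywhere differentiability of indefinite integrals.
\<close>

section \<open>Smooth cutoff functions\<close>

text \<open>The obstacle is the top order term. Membership in H^4 gives three classical derivatives
  of phi, while the fourth, \<open>g\<close>, is only determined almost everywhere and phi''' is
  known in the form \<open>C + integral {a..x} g\<close>. The usual fundamental theorem, which wants
  a derivative at every point, does not integrate cnj phi * phi'''' by parts. The derivative is put
  on the smooth factor instead, using only that phi''' - C is a primitive of \<open>g\<close>.

  The boundary conditions remove all boundary terms: phi = 0 those with cnj phi * phi' and cnj phi *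
  phi''', and phi'' = 0 the one with cnj phi' * phi''. There remain -|phi'|^2 and |phi''|^2, both
  real.

  Positivity of Im c enters twice: V - c has no zero, so the quotient is defined and continuous up
  to the walls, and the weight in front of U'' |phi|^2 has no zero except where phi
  vanishes.\<close>

fun times_diff :: "nat \<Rightarrow> (real \<Rightarrow> real) \<Rightarrow> bool" where
  "times_diff 0 f = True"
| "times_diff (Suc n) f =
     (\<exists>f'. (\<forall>x. (f has_real_derivative f' x) (at x)) \<and> times_diff n f')"

lemma times_diff_SucI:
  "(\<And>x. (f has_real_derivative f' x) (at x)) \<Longrightarrow> times_diff n f' \<Longrightarrow> times_diff (Suc n) f"
  by auto

lemma times_diff_Suc_imp: "times_diff (Suc n) f \<Longrightarrow> times_diff n f"
proof (induction n arbitrary: f)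
  case (Suc n)
  then obtain f' where "\<forall>x. (f has_real_derivative f' x) (at x)" "times_diff (Suc n) f'"
    by auto
  with Suc.IH[of f'] show ?case by auto
qed simp

text \<open>The derivative in \<open>times_diff\<close> is hidden behind an existential, so closure
  properties follow by induction on the order, without formulas for the iterates of
  \<open>deriv_on\<close>. Two free coefficients cover sums, differences and scalar multiples at
  once.\<close>

lemma times_diff_lincomb:
  "times_diff n f \<Longrightarrow> times_diff n g \<Longrightarrow> times_diff n (\<lambda>x. r * f x + s * g x)"
proof (induction n arbitrary: f g)
  case (Suc n)
  then obtain f' g' where f: "\<forall>x. (f has_real_derivative f' x) (at x)" "times_diff n f'"
    and g: "\<forall>x. (g has_real_derivative g' x) (at x)" "times_diff n g'"
    by auto
  have "((\<lambda>x. r * f x + s * g x) has_real_derivative r * f' x + s * g' x) (at x)" for x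
    by (intro DERIV_add DERIV_cmult f(1)[rule_format] g(1)[rule_format])
  with Suc.IH[OF f(2) g(2)] show ?case by (rule times_diff_SucI[rotated])
qed simp

lemma times_diff_mult:
  "times_diff n f \<Longrightarrow> times_diff n g \<Longrightarrow> times_diff n (\<lambda>x. f x * g x)"
proof (induction n arbitrary: f g)
  case (Suc n)
  then obtain f' g' where f: "\<forall>x. (f has_real_derivative f' x) (at x)" "times_diff n f'"
    and g: "\<forall>x. (g has_real_derivative g' x) (at x)" "times_diff n g'"
    by auto
  have "times_diff n f" "times_diff n g"
    using Suc.prems times_diff_Suc_imp by blast+
  then have "times_diff n (\<lambda>x. f' x * g x)" "times_diff n (\<lambda>x. g' x * f x)"
    using Suc.IH f(2) g(2) by blast+
  then have "times_diff n (\<lambda>x. 1 * (f' x * g x) + 1 * (g' x * f x))"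
    by (rule times_diff_lincomb)
  moreover have "((\<lambda>x. f x * g x) has_real_derivative 1 * (f' x * g x) + 1 * (g' x * f x)) (at x)" for x
    using DERIV_mult[OF f(1)[rule_format] g(1)[rule_format]] by simp
  ultimately show ?case by (rule times_diff_SucI[rotated])
qed simp

lemma times_diff_affine:
  "times_diff n f \<Longrightarrow> times_diff n (\<lambda>x. f (r * x + s))"
proof (induction n arbitrary: f)
  case (Suc n)
  then obtain f' where f: "\<forall>x. (f has_real_derivative f' x) (at x)" "times_diff n f'"
    by auto
  \<comment> \<open>The summand with coefficient 0 turns closure under linear combinations into
    closure under scalar multiples.\<close>
  have "times_diff n (\<lambda>x. r * f' (r * x + s) + 0 * f' (r * x + s))"
    using Suc.IH[OF f(2)] times_diff_lincomb by blast
  then have "times_diff n (\<lambda>x. f' (r * x + s) * r)"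
    by (simp add: mult.commute)
  moreover have "((\<lambda>x. f (r * x + s)) has_real_derivative f' (r * x + s) * r) (at x)" for x
    by (rule DERIV_chain2[OF f(1)[rule_format]]) (auto intro!: derivative_eq_intros)
  ultimately show ?case by (rule times_diff_SucI[rotated])
qed simp

lemma deriv_on_UNIV_eq:
  "\<forall>x. (f has_real_derivative f' x) (at x) \<Longrightarrow> deriv_on UNIV f = f'"
  unfolding deriv_on_def has_real_derivative_iff_has_vector_derivative
  by (auto intro!: ext vector_derivative_at)

lemma smooth_onI:
  assumes "\<And>n. times_diff n f"
  shows "smooth_on UNIV f"
proof -
  have "(deriv_on UNIV ^^ n) f differentiable_on UNIV" if "times_diff (Suc n) f" for n
    using that
  proof (induction n arbitrary: f)
    case 0
    then show ?case
      by (auto simp: differentiable_on_def real_differentiable_def)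
  next
    case (Suc n)
    then obtain f' where f': "\<forall>x. (f has_real_derivative f' x) (at x)" "times_diff (Suc n) f'"
      by (metis times_diff.simps(2))
    have "(deriv_on UNIV ^^ Suc n) f = (deriv_on UNIV ^^ n) f'"
      by (simp add: funpow_Suc_right deriv_on_UNIV_eq[OF f'(1)] del: funpow.simps)
    with Suc.IH[OF f'(2)] show ?case by simp
  qed
  with assms show ?thesis unfolding smooth_on_def by blast
qed

lemma smooth_on_deriv: "smooth_on UNIV f \<Longrightarrow> smooth_on UNIV (deriv_on UNIV f)"
  unfolding smooth_on_def by (metis funpow_Suc_right comp_apply)

lemma smooth_on_has_deriv:
  assumes "smooth_on S f" "x \<in> S"
  shows "((deriv_on S ^^ n) f has_vector_derivative (deriv_on S ^^ Suc n) f x) (at x within S)"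
  using has_deriv_on assms unfolding smooth_on_def by fastforce

section \<open>The flat function exp (-1/x) and the bumps built from it\<close>

definition flat :: "nat \<Rightarrow> real \<Rightarrow> real" where
  "flat k x = (if x > 0 then (1 / x) ^ k * exp (- (1 / x)) else 0)"

text \<open>The powers of 1/x are part of the family because differentiating exp (-1/x) produces
  them: each derivative is a linear combination of members of higher index. Smoothness then follows
  by induction over all indices together.\<close>

lemma flat_has_derivative: "(flat k has_real_derivative flat (k + 2) x - k * flat (k + 1) x) (at x)"
proof -
  consider "x < 0" | "x = 0" | "x > 0" by linarith
  then show ?thesis
  proof cases
    case 1
    have "((\<lambda>_. 0) has_real_derivative flat (k + 2) x - k * flat (k + 1) x) (at x)"
      using 1 by (simp add: flat_def)
    then show ?thesis
      by (rule has_field_derivative_transform_within_open[where S = "{..<0}"])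
        (use 1 in \<open>auto simp: flat_def\<close>)
  next
    case 3
    have "((\<lambda>x. (1 / x) ^ k * exp (- (1 / x))) has_real_derivative flat (k + 2) x - k * flat (k + 1) x) (at x)"
    proof -
      have "((\<lambda>x. (1 / x) ^ k) has_real_derivative - (k * (1 / x) ^ (k + 1))) (at x)"
        by (rule DERIV_cong[OF DERIV_power[where f = "\<lambda>x. 1 / x" and D = "- ((1 / x) * (1 / x))"]])
          (use 3 in \<open>auto intro!: derivative_eq_intros simp: power2_eq_square power_eq_if[of "1 / x" k]\<close>)
      moreover have "((\<lambda>x. exp (- (1 / x))) has_real_derivative exp (- (1 / x)) * (1 / x)\<^sup>2) (at x)"
        using 3 by (auto intro!: derivative_eq_intros simp: power2_eq_square)
      ultimately show ?thesis
        by (rule DERIV_cong[OF DERIV_mult])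
          (use 3 in \<open>simp add: flat_def algebra_simps power2_eq_square\<close>)
    qed
    then show ?thesis
      by (rule has_field_derivative_transform_within_open[where S = "{0<..}"])
        (use 3 in \<open>auto simp: flat_def\<close>)
  next
    case 2
    \<comment> \<open>At 0 the right difference quotient is (1/h)^(k+1) exp (-1/h), which becomes
      this limit under y = 1/h. The left difference quotient is identically 0.\<close>
    have "((\<lambda>y. y ^ Suc k / exp y) \<longlongrightarrow> (0::real)) at_top"
      by (rule tendsto_power_div_exp_0)
    then have "((\<lambda>h. inverse h ^ Suc k / exp (inverse h)) \<longlongrightarrow> (0::real)) (at_right 0)"
      by (rule filterlim_compose) (rule filterlim_inverse_at_top_right)
    then have "((\<lambda>h. (flat k (0 + h) - flat k 0) / h) \<longlongrightarrow> 0) (at_right 0)"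
      by (rule Lim_transform_eventually)
        (auto simp: flat_def eventually_at_filter exp_minus field_simps)
    moreover have "((\<lambda>h. (flat k (0 + h) - flat k 0) / h) \<longlongrightarrow> 0) (at_left 0)"
      by (rule tendsto_eventually) (auto simp: flat_def eventually_at_filter)
    ultimately have "((\<lambda>h. (flat k (0 + h) - flat k 0) / h) \<longlongrightarrow> 0) (at 0)"
      using filterlim_split_at by blast
    then have "(flat k has_real_derivative 0) (at 0)"
      unfolding DERIV_def .
    moreover have "flat (k + 2) x - k * flat (k + 1) x = 0"
      using 2 by (simp add: flat_def)
    ultimately show ?thesis
      using 2 by (simp only:)
  qed
qed

lemma times_diff_flat: "times_diff n (flat k)"
proof (induction n arbitrary: k)
  case (Suc n)
  have "times_diff n (\<lambda>x. 1 * flat (k + 2) x + (- real k) * flat (k + 1) x)"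
    using Suc.IH times_diff_lincomb by blast
  moreover have "(flat k has_real_derivative 1 * flat (k + 2) x + (- real k) * flat (k + 1) x) (at x)" for x
    using flat_has_derivative[of k x] by simp
  ultimately show ?case by (rule times_diff_SucI[rotated])
qed simp

text \<open>The factor \<open>Suc n\<close> steepens both flanks while the support stays in
  \<open>{c..d}\<close>. The bump never reaches 1 but tends to 1 at each interior point, which is
  enough for dominated convergence.\<close>

definition cutoff :: "real \<Rightarrow> real \<Rightarrow> nat \<Rightarrow> real \<Rightarrow> real" where
  "cutoff c d n x = flat 0 (real (Suc n) * (x - c)) * flat 0 (real (Suc n) * (d - x))"

lemma times_diff_cutoff: "times_diff m (cutoff c d n)"
proof -
  have "times_diff m (\<lambda>x. flat 0 (real (Suc n) * x + (- (real (Suc n) * c))) * flat 0 ((- real (Suc n)) * x + real (Suc n) * d))"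
    by (intro times_diff_mult times_diff_affine times_diff_flat)
  moreover have "(\<lambda>x. flat 0 (real (Suc n) * x + (- (real (Suc n) * c))) * flat 0 ((- real (Suc n)) * x + real (Suc n) * d)) = cutoff c d n"
    by (auto simp: cutoff_def fun_eq_iff algebra_simps)
  ultimately show ?thesis by (simp only:)
qed

lemma flat_bounds: "0 \<le> flat 0 x" "flat 0 x \<le> 1"
  by (auto simp: flat_def)

lemma cutoff_bounds: "0 \<le> cutoff c d n x" "cutoff c d n x \<le> 1"
  by (auto simp: cutoff_def flat_bounds mult_le_one)

lemma cutoff_eq_0: "x \<le> c \<or> d \<le> x \<Longrightarrow> cutoff c d n x = 0"
  by (auto simp: cutoff_def flat_def mult_le_0_iff not_less zero_less_mult_iff)

lemma cutoff_tendsto: "(\<lambda>n. cutoff c d n x) \<longlonglongrightarrow> indicator {c<..<d} x"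
proof (cases "c < x \<and> x < d")
  case True
  have *: "(\<lambda>n. flat 0 (real (Suc n) * y)) \<longlonglongrightarrow> 1" if "y > 0" for y
  proof -
    have "(\<lambda>n. exp (- (inverse (real (Suc n)) / y))) \<longlonglongrightarrow> exp (- (0 / y))"
      by (intro tendsto_intros LIMSEQ_inverse_real_of_nat) (use that in auto)
    moreover have "flat 0 (real (Suc n) * y) = exp (- (inverse (real (Suc n)) / y))" for n
      using that by (simp add: flat_def divide_inverse del: of_nat_Suc)
    ultimately show ?thesis
      by (simp only: div_0 minus_zero exp_zero)
  qed
  have "(\<lambda>n. cutoff c d n x) \<longlonglongrightarrow> 1 * 1"
    unfolding cutoff_def by (intro tendsto_mult *) (use True in auto)
  then show ?thesis using True by simp
next
  case False
  then have "cutoff c d n x = 0" for n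
    by (auto intro!: cutoff_eq_0)
  then show ?thesis using False by simp
qed

lemma cutoff_shift: "cutoff c d n (x - s) = cutoff (c + s) (d + s) n x"
proof -
  have "x - s - c = x - (c + s)" "d - (x - s) = d + s - x" by simp_all
  then show ?thesis by (simp only: cutoff_def)
qed

lemma continuous_on_cutoff: "continuous_on T (cutoff c d n)"
proof -
  obtain w' where "\<And>x. (cutoff c d n has_real_derivative w' x) (at x)"
    using times_diff_cutoff[of 1 c d n] by auto
  then show ?thesis
    by (blast intro: DERIV_continuous_on has_field_derivative_at_within)
qed

text \<open>A bump minus its translate has mean zero, so its antiderivative vanishes again to the
  right of both and is compactly supported. With \<open>F\<close> an antiderivative of the bump,
  this is \<open>F x - F (x - s)\<close>, supported in \<open>{c..d + s}\<close>.\<close>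

lemma test_function_cutoff_diff:
  assumes "a < c" "c < d" "0 \<le> s" "d + s < b"
  obtains \<eta> where "test_function a b \<eta>"
    "deriv_on UNIV \<eta> = (\<lambda>x. cutoff c d n x - cutoff (c + s) (d + s) n x)"
proof -
  define w where "w = cutoff c d n"
  have contw: "continuous_on T w" for T
    by (simp add: w_def continuous_on_cutoff)
  have w0: "w x = 0" if "x \<le> c \<or> d \<le> x" for x
    using cutoff_eq_0 that by (simp add: w_def)
  define F where "F x = integral {c..x} w" for x
  \<comment> \<open>Moving the base point to the left of both \<open>c\<close> and \<open>x\<close>
    gives a two-sided derivative at every \<open>x\<close>. For \<open>x < c\<close> the interval
    \<open>{c..x}\<close> is empty, which fits because the bump vanishes there.\<close>
  have F_eq: "F x = integral {L..x} w" if "L \<le> c" for L x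
  proof (cases "c \<le> x")
    case True
    have "integral {L..c} w + integral {c..x} w = integral {L..x} w"
      by (intro Henstock_Kurzweil_Integration.integral_combine integrable_continuous_real contw)
        (use True that in auto)
    moreover have "integral {L..c} w = 0"
      using integral_cong[of "{L..c}" w "\<lambda>_. 0"] w0 by simp
    ultimately show ?thesis by (simp add: F_def)
  next
    case False
    then show ?thesis
      using integral_cong[of "{L..x}" w "\<lambda>_. 0"] w0 by (simp add: F_def)
  qed
  have F: "(F has_real_derivative w x) (at x)" for x
  proof -
    define L where "L = min c x - 1"
    have L: "L \<le> c" "L < x" by (auto simp: L_def)
    have "((\<lambda>u. integral {L..u} w) has_real_derivative w x) (at x within {L..x+1})"
      by (rule integral_has_real_derivative[OF contw]) (use L in auto)
    then have "((\<lambda>u. integral {L..u} w) has_real_derivative w x) (at x)"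
      using at_within_Icc_at[of L x "x + 1"] L by simp
    then show ?thesis
      by (simp only: F_eq[OF L(1), symmetric])
  qed
  have F_const: "F x = F d" if "d \<le> x" for x
  proof -
    have "integral {c..d} w + integral {d..x} w = integral {c..x} w"
      by (intro Henstock_Kurzweil_Integration.integral_combine integrable_continuous_real contw)
        (use that assms in auto)
    moreover have "integral {d..x} w = 0"
      using integral_cong[of "{d..x}" w "\<lambda>_. 0"] w0 by simp
    ultimately show ?thesis by (simp add: F_def)
  qed
  have F_0: "F x = 0" if "x \<le> c" for x
    using that by (cases "x = c") (auto simp: F_def)
  have smF: "times_diff m F" for m
    using times_diff_Suc_imp[OF times_diff_SucI[OF F]] times_diff_cutoff
    by (simp add: w_def)
  define \<eta> where "\<eta> x = F x - F (x - s)" for x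
  have "times_diff m (\<lambda>x. 1 * F x + (- 1) * F (1 * x + (- s)))" for m
    by (intro times_diff_lincomb times_diff_affine smF)
  then have "smooth_on UNIV \<eta>"
    by (intro smooth_onI) (simp add: \<eta>_def[abs_def])
  moreover have "\<eta> y = 0" if "y \<notin> {c..d + s}" for y
    using that assms F_0[of y] F_0[of "y - s"] F_const[of y] F_const[of "y - s"] by (auto simp: \<eta>_def)
  ultimately have "test_function a b \<eta>"
    unfolding test_function_def using assms by blast
  moreover have "(\<eta> has_real_derivative w x - w (x - s)) (at x)" for x
    unfolding \<eta>_def
    by (intro DERIV_diff F DERIV_chain2[OF F, THEN DERIV_cong]) (auto intro!: derivative_eq_intros)
  then have "deriv_on UNIV \<eta> = (\<lambda>x. w x - w (x - s))"
    by (intro deriv_on_UNIV_eq) auto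
  ultimately show ?thesis
    using that by (simp add: w_def cutoff_shift)
qed

section \<open>Indefinite integrals\<close>

text \<open>Lebesgue's differentiation theorem in the form used here controls averages over
  intervals starting at the point, hence only right derivatives. Left derivatives come from the
  reflected function, whose exceptional set is reflected back. Extension by 0 provides integrability
  on every interval.\<close>

proposition integral_has_vector_derivative_ae:
  fixes f :: "real \<Rightarrow> 'b::euclidean_space"
  assumes f: "f integrable_on {a..b}"
  obtains N where "negligible N"
    "\<And>x. x \<in> {a..b} - N \<Longrightarrow> ((\<lambda>u. integral {a..u} f) has_vector_derivative f x) (at x within {a..b})"
proof -
  define f0 where "f0 x = (if x \<in> {a..b} then f x else 0)" for x
  have "f0 integrable_on UNIV"
    using f integrable_restrict_UNIV[of "{a..b}" f] by (simp add: f0_def[abs_def])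
  then have f0: "f0 integrable_on cbox c d" for c d
    by (rule integrable_on_subcbox) simp
  have f0m: "(\<lambda>x. f0 (- x)) integrable_on cbox c d" for c d
    using Henstock_Kurzweil_Integration.integrable_reflect_real[where f = f0 and a = "- d" and b = "- c"] f0 by simp
  obtain N1 where N1: "negligible N1"
    "\<And>x e. x \<notin> N1 \<Longrightarrow> 0 < e \<Longrightarrow> \<exists>d>0. \<forall>h. 0 < h \<and> h < d \<longrightarrow>
       norm (integral (cbox x (x + h *\<^sub>R One)) f0 /\<^sub>R h ^ DIM(real) - f0 x) < e"
    using integrable_ccontinuous_explicit[OF f0] by metis
  obtain N2 where N2: "negligible N2"
    "\<And>x e. x \<notin> N2 \<Longrightarrow> 0 < e \<Longrightarrow> \<exists>d>0. \<forall>h. 0 < h \<and> h < d \<longrightarrow>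
       norm (integral (cbox x (x + h *\<^sub>R One)) (\<lambda>x. f0 (- x)) /\<^sub>R h ^ DIM(real) - f0 (- x)) < e"
    using integrable_ccontinuous_explicit[OF f0m] by metis
  define F where "F u = integral {a..u} f" for u
  have diff: "F v - F u = integral {u..v} f0" if "a \<le> u" "u \<le> v" "v \<le> b" for u v
  proof -
    have "integral {a..u} f + integral {u..v} f = integral {a..v} f"
      by (intro Henstock_Kurzweil_Integration.integral_combine integrable_subinterval_real[OF f]) (use that in auto)
    moreover have "integral {u..v} f = integral {u..v} f0"
      by (rule integral_cong) (use that in \<open>auto simp: f0_def\<close>)
    ultimately show ?thesis by (simp add: F_def algebra_simps)
  qed
  have quot: "norm (I - h *\<^sub>R y) / h = norm (I /\<^sub>R h - y)" if "h > 0" for h and I y :: 'b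
  proof -
    have "I /\<^sub>R h - y = (I - h *\<^sub>R y) /\<^sub>R h"
      using that by (simp add: scaleR_diff_right)
    then show ?thesis
      using that by (simp add: divide_inverse)
  qed
  have "(F has_vector_derivative f x) (at x within {a..b})"
    if x: "x \<in> {a..b} - (N1 \<union> uminus ` N2)" for x
    unfolding has_vector_derivative_def has_derivative_within'
  proof (intro conjI allI impI)
    show "bounded_linear (\<lambda>h. h *\<^sub>R f x)" by (rule bounded_linear_scaleR_left)
    fix e :: real assume "e > 0"
    have fx: "f0 x = f x" using x by (simp add: f0_def)
    have "x \<notin> N1" "- x \<notin> N2" using x by force+
    obtain d1 where d1: "d1 > 0"
      "\<And>h. 0 < h \<Longrightarrow> h < d1 \<Longrightarrow> norm (integral {x..x + h} f0 /\<^sub>R h - f x) < e"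
      using N1(2)[OF \<open>x \<notin> N1\<close> \<open>e > 0\<close>] by (auto simp: fx)
    obtain d2 where d2: "d2 > 0"
      "\<And>h. 0 < h \<Longrightarrow> h < d2 \<Longrightarrow> norm (integral {- x..- x + h} (\<lambda>x. f0 (- x)) /\<^sub>R h - f x) < e"
      using N2(2)[OF \<open>- x \<notin> N2\<close> \<open>e > 0\<close>] by (auto simp: fx)
    have "norm (F u - F x - (u - x) *\<^sub>R f x) / norm (u - x) < e"
      if u: "u \<in> {a..b}" "0 < norm (u - x)" "norm (u - x) < min d1 d2" for u
    proof (cases "x < u")
      case True
      then have "norm (F u - F x - (u - x) *\<^sub>R f x) / norm (u - x)
          = norm (integral {x..x + (u - x)} f0 /\<^sub>R (u - x) - f x)"
        using diff[of x u] quot[of "u - x" "integral {x..u} f0" "f x"] x u by simp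
      also have "\<dots> < e"
        by (rule d1(2)) (use True u in auto)
      finally show ?thesis .
    next
      case False
      then have "u < x" using u by auto
      have "norm (F u - F x - (u - x) *\<^sub>R f x) = norm (F x - F u - (x - u) *\<^sub>R f x)"
      proof -
        have "F u - F x - (u - x) *\<^sub>R f x = - (F x - F u - (x - u) *\<^sub>R f x)"
          by (simp add: scaleR_diff_left)
        then show ?thesis by (simp only: norm_minus_cancel)
      qed
      also have "F x - F u = integral {u..x} f0"
        using diff[of u x] x u \<open>u < x\<close> by simp
      also have "\<dots> = integral {- x..- x + (x - u)} (\<lambda>x. f0 (- x))"
        using Henstock_Kurzweil_Integration.integral_reflect_real[where f = f0 and a = u and b = x] by simp
      finally have "norm (F u - F x - (u - x) *\<^sub>R f x) / norm (u - x)
          = norm (integral {- x..- x + (x - u)} (\<lambda>x. f0 (- x)) /\<^sub>R (x - u) - f x)"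
        using quot[of "x - u"] \<open>u < x\<close> by simp
      also have "\<dots> < e"
        by (rule d2(2)) (use \<open>u < x\<close> u in auto)
      finally show ?thesis .
    qed
    then show "\<exists>d>0. \<forall>u\<in>{a..b}. 0 < norm (u - x) \<and> norm (u - x) < d \<longrightarrow>
        norm (F u - F x - (u - x) *\<^sub>R f x) / norm (u - x) < e"
      using d1 d2 by (intro exI[of _ "min d1 d2"]) auto
  qed
  moreover have "negligible (N1 \<union> uminus ` N2)"
    using N1(1) negligible_differentiable_image_negligible[OF _ N2(1), of uminus] by (simp add: negligible_Un differentiable_on_minus)
  ultimately show ?thesis
    using that unfolding F_def by blast
qed

lemma absolutely_integrable_continuous_mult:
  fixes f g :: "real \<Rightarrow> complex"
  assumes "continuous_on {a..b} f" "g absolutely_integrable_on {a..b}"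
  shows "(\<lambda>x. f x * g x) absolutely_integrable_on {a..b}"
  using assms
  by (intro absolutely_integrable_bounded_measurable_product[OF bilinear_times])
    (auto intro: continuous_imp_measurable_on_sets_lebesgue compact_imp_bounded compact_continuous_image)

text \<open>
  The difference of the two sides over \<open>{a..x}\<close> is differentiable with derivative \<open>0\<close> at every
  \<open>x\<close>, because its increment over \<open>{u..v}\<close> is at most a constant times \<open>v - u\<close> times the
  integral of \<open>norm g\<close> over \<open>{u..v}\<close>. No differentiability of the primitive of \<open>g\<close> is needed.
\<close>

lemma has_integral_by_parts_primitive:
  fixes f f' g :: "real \<Rightarrow> complex"
  assumes ab: "a \<le> b"
    and f: "\<And>x. x \<in> {a..b} \<Longrightarrow> (f has_vector_derivative f' x) (at x within {a..b})"
    and f': "continuous_on {a..b} f'"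
    and g: "g absolutely_integrable_on {a..b}"
  shows "((\<lambda>x. f x * g x) has_integral
    f b * integral {a..b} g - integral {a..b} (\<lambda>x. f' x * integral {a..x} g)) {a..b}"
proof -
  define G where "G x = integral {a..x} g" for x
  define P where "P x = integral {a..x} (\<lambda>x. norm (g x))" for x
  have gi: "g integrable_on {a..b}" "(\<lambda>x. norm (g x)) integrable_on {a..b}"
    using g absolutely_integrable_on_def by blast+
  have contf: "continuous_on {a..b} f"
    using f has_vector_derivative_continuous continuous_on_eq_continuous_within by blast
  have contG: "continuous_on {a..b} G" and contP: "continuous_on {a..b} P"
    unfolding G_def P_def by (rule indefinite_integral_continuous_1 gi)+
  have fg: "(\<lambda>x. f x * g x) integrable_on {a..b}"
    using absolutely_integrable_continuous_mult[OF contf g] absolutely_integrable_on_def by blast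
  have f'G: "continuous_on {a..b} (\<lambda>x. f' x * G x)"
    by (intro continuous_intros f' contG)
  obtain L where L: "L > 0" "\<And>x. x \<in> {a..b} \<Longrightarrow> norm (f' x) \<le> L"
    using compact_imp_bounded[OF compact_continuous_image[OF f' compact_Icc]]
    unfolding bounded_pos by auto
  define K where "K x = integral {a..x} (\<lambda>x. f x * g x) + integral {a..x} (\<lambda>x. f' x * G x) - f x * G x" for x
  have inc: "norm (K v - K u) \<le> 2 * L * ((v - u) * (P v - P u))"
    if uv: "a \<le> u" "u \<le> v" "v \<le> b" for u v
  proof -
    have sub: "{u..v} \<subseteq> {a..b}" using uv by auto
    have comb: "integral {a..v} h - integral {a..u} h = integral {u..v} h"
      if "h integrable_on {a..b}" for h :: "real \<Rightarrow> 'c::banach"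
      using Henstock_Kurzweil_Integration.integral_combine[OF uv(1,2) integrable_subinterval_real[OF that]]
        uv by (simp add: algebra_simps)
    have FT: "(f' has_integral f t - f s) {s..t}" if "u \<le> s" "s \<le> t" "t \<le> v" for s t
    proof (rule fundamental_theorem_of_calculus[OF that(2)])
      fix x assume "x \<in> {s..t}"
      then show "(f has_vector_derivative f' x) (at x within {s..t})"
        using has_vector_derivative_within_subset[OF f] that uv by auto
    qed
    have Pm: "norm (G s - G u) \<le> P v - P u" if "s \<in> {u..v}" for s
    proof -
      have int: "g integrable_on {u..s}" "(\<lambda>x. norm (g x)) integrable_on {u..s}" "(\<lambda>x. norm (g x)) integrable_on {u..v}"
        using that uv by (auto intro: integrable_subinterval_real gi)
      have "G s - G u = integral {u..s} g"
        using Henstock_Kurzweil_Integration.integral_combine[OF uv(1), of s g] that uv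
          integrable_subinterval_real[OF gi(1)] by (simp add: G_def algebra_simps)
      then have "norm (G s - G u) \<le> integral {u..s} (\<lambda>x. norm (g x))"
        by (simp add: integral_norm_bound_integral int)
      also have "\<dots> \<le> integral {u..v} (\<lambda>x. norm (g x))"
        by (rule integral_subset_le) (use that int in auto)
      also have "\<dots> = P v - P u"
        using comb[OF gi(2)] by (simp add: P_def)
      finally show ?thesis .
    qed
    have P0: "0 \<le> P v - P u"
      using order_trans[OF norm_ge_zero Pm[of u]] uv by simp
    have i1: "(\<lambda>s. (f s - f v) * g s) integrable_on {u..v}"
    proof -
      have "continuous_on {a..b} (\<lambda>s. f s - f v)"
        by (intro continuous_intros contf)
      from absolutely_integrable_continuous_mult[OF this g] show ?thesis
        using integrable_subinterval_real[OF _ sub] absolutely_integrable_on_def by blast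
    qed
    have i2: "(\<lambda>s. f' s * (G s - G u)) integrable_on {u..v}"
      by (intro integrable_continuous_real continuous_intros
          continuous_on_subset[OF f' sub] continuous_on_subset[OF contG sub])
    have "norm (integral {u..v} (\<lambda>s. (f s - f v) * g s)) \<le> integral {u..v} (\<lambda>s. L * (v - u) * norm (g s))"
    proof (rule integral_norm_bound_integral[OF i1])
      show "(\<lambda>s. L * (v - u) * norm (g s)) integrable_on {u..v}"
        by (rule integrable_on_mult_right[OF integrable_subinterval_real[OF gi(2) sub]])
      fix s assume s: "s \<in> {u..v}"
      have "norm (f v - f s) \<le> L * measure lborel {s..v}"
        by (rule has_integral_bound_real[OF _ _ FT]) (use L s uv in auto)
      also have "\<dots> \<le> L * (v - u)" using s L by simp
      finally show "norm ((f s - f v) * g s) \<le> L * (v - u) * norm (g s)"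
        by (simp add: norm_mult norm_minus_commute mult_right_mono)
    qed
    also have "\<dots> = L * (v - u) * (P v - P u)"
      using comb[OF gi(2)] by (simp add: P_def)
    finally have b1: "norm (integral {u..v} (\<lambda>s. (f s - f v) * g s)) \<le> L * (v - u) * (P v - P u)" .
    have "norm (integral {u..v} (\<lambda>s. f' s * (G s - G u))) \<le> (L * (P v - P u)) * measure lborel {u..v}"
    proof (rule has_integral_bound_real[OF _ _ integrable_integral[OF i2]])
      show "0 \<le> L * (P v - P u)" using P0 L by simp
      fix s assume "s \<in> {u..v} - {}"
      then show "norm (f' s * (G s - G u)) \<le> L * (P v - P u)"
        using Pm[of s] L sub by (auto simp: norm_mult intro!: mult_mono)
    qed auto
    then have b2: "norm (integral {u..v} (\<lambda>s. f' s * (G s - G u))) \<le> L * (v - u) * (P v - P u)"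
      using uv by (simp add: mult_ac)
    have e1: "integral {u..v} (\<lambda>s. (f s - f v) * g s) = integral {u..v} (\<lambda>s. f s * g s) - f v * (G v - G u)"
      using integrable_subinterval_real[OF fg sub] integrable_subinterval_real[OF gi(1) sub] comb[OF gi(1)]
      by (simp add: left_diff_distrib Henstock_Kurzweil_Integration.integral_diff integrable_on_mult_right G_def)
    have "integral {u..v} (\<lambda>s. f' s * (G s - G u))
        = integral {u..v} (\<lambda>s. f' s * G s) - integral {u..v} (\<lambda>s. f' s * G u)"
      unfolding right_diff_distrib
      by (intro Henstock_Kurzweil_Integration.integral_diff integrable_continuous_real continuous_intros
          continuous_on_subset[OF f' sub] continuous_on_subset[OF contG sub])
    also have "integral {u..v} (\<lambda>s. f' s * G u) = (f v - f u) * G u"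
      using integral_unique[OF has_integral_mult_left[OF FT[of u v]]] uv by simp
    finally have e2: "integral {u..v} (\<lambda>s. f' s * (G s - G u))
        = integral {u..v} (\<lambda>s. f' s * G s) - (f v - f u) * G u" .
    \<comment> \<open>Subtracting \<open>f v\<close> in one integrand and \<open>G u\<close> in the
      other makes the mixed products \<open>f v * G u\<close> cancel. Each integrand now contains
      one small factor, of size \<open>L * (v - u)\<close> or \<open>P v - P u\<close>.\<close>
    have "K v - K u = integral {u..v} (\<lambda>s. (f s - f v) * g s) + integral {u..v} (\<lambda>s. f' s * (G s - G u))"
      unfolding e1 e2
      using comb[OF fg] comb[OF integrable_continuous_real[OF f'G]]
      by (simp add: K_def algebra_simps)
    then show ?thesis
      using norm_triangle_mono[OF b1 b2] by simp
  qed
  have "(K has_vector_derivative 0) (at x within {a..b})" if x: "x \<in> {a..b}" for x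
    unfolding has_vector_derivative_def has_derivative_within'
  proof (intro conjI allI impI)
    show "bounded_linear (\<lambda>h. h *\<^sub>R (0::complex))" by simp
    fix e :: real assume "e > 0"
    then have "e / (2 * L) > 0" using L by simp
    \<comment> \<open>Continuity of \<open>P\<close> makes the bound on the increment of
      \<open>K\<close> of smaller order than \<open>y - x\<close>. The choice
      \<open>e / (2 * L)\<close> compensates the constant \<open>2 * L\<close> in
      \<open>inc\<close>.\<close>
    then obtain d where d: "d > 0" "\<And>y. y \<in> {a..b} \<Longrightarrow> dist y x < d \<Longrightarrow> dist (P y) (P x) < e / (2 * L)"
      using contP x unfolding continuous_on_iff by metis
    have "norm (K y - K x) / norm (y - x) < e"
      if y: "y \<in> {a..b}" "0 < norm (y - x)" "norm (y - x) < d" for y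
    proof -
      have "norm (K y - K x) \<le> 2 * L * (\<bar>y - x\<bar> * \<bar>P y - P x\<bar>)"
      proof (cases "x \<le> y")
        case True
        then have "norm (K y - K x) \<le> 2 * L * ((y - x) * (P y - P x))"
          using inc x y by auto
        also have "\<dots> \<le> 2 * L * (\<bar>y - x\<bar> * \<bar>P y - P x\<bar>)"
          using L abs_ge_self[of "(y - x) * (P y - P x)"] by (simp add: abs_mult)
        finally show ?thesis .
      next
        case False
        then have "norm (K y - K x) \<le> 2 * L * ((x - y) * (P x - P y))"
          using inc[of y x] x y by (auto simp: norm_minus_commute)
        also have "\<dots> \<le> 2 * L * (\<bar>y - x\<bar> * \<bar>P y - P x\<bar>)"
          using L abs_ge_self[of "(x - y) * (P x - P y)"]
          by (simp add: abs_mult abs_minus_commute)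
        finally show ?thesis .
      qed
      also have "\<dots> < 2 * L * (\<bar>y - x\<bar> * (e / (2 * L)))"
        using d(2)[of y] y L by (simp add: dist_norm pos_less_divide_eq mult_ac)
      also have "\<dots> = e * norm (y - x)"
        using L by simp
      finally show ?thesis
        using y by (simp add: divide_less_eq)
    qed
    then show "\<exists>d>0. \<forall>y\<in>{a..b}. 0 < norm (y - x) \<and> norm (y - x) < d \<longrightarrow>
        norm (K y - K x - (y - x) *\<^sub>R 0) / norm (y - x) < e"
      using d(1) by auto
  qed
  then have "((\<lambda>_. 0) has_integral K b - K a) {a..b}"
    by (intro fundamental_theorem_of_calculus ab)
  then have "K b = K a" using has_integral_0 has_integral_unique
    by (metis eq_iff_diff_eq_0)
  moreover have "K a = 0" by (simp add: K_def G_def)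
  ultimately have "K b = 0" by simp
  then have "integral {a..b} (\<lambda>x. f x * g x) = f b * G b - integral {a..b} (\<lambda>x. f' x * G x)"
    by (simp add: K_def algebra_simps)
  then show ?thesis
    using integrable_integral[OF fg] by (simp add: G_def)
qed

section \<open>Weak derivatives\<close>

lemma integrable_lebesgue_on_iff:
  fixes f :: "real \<Rightarrow> 'a::euclidean_space"
  shows "integrable (lebesgue_on {a..b}) f \<longleftrightarrow> f absolutely_integrable_on {a..b}"
  by (simp add: set_integrable_def integrable_restrict_space)

lemma AE_lebesgue_on_negligibleI:
  fixes a b :: real
  assumes "negligible N" "\<And>x. x \<in> {a..b} - N \<Longrightarrow> P x"
  shows "AE x in lebesgue_on {a..b}. P x"
proof -
  have "AE x in lebesgue. x \<notin> N"
    using assms(1) by (simp add: negligible_iff_null_sets AE_not_in)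
  then show ?thesis
    using assms(2) by (auto simp: AE_restrict_space_iff elim: eventually_mono)
qed

lemma AE_lebesgue_on_negligibleE:
  fixes a b :: real
  assumes "AE x in lebesgue_on {a..b}. P x"
  obtains N where "negligible N" "\<forall>x\<in>{a..b} - N. P x"
proof -
  have "AE x in lebesgue. x \<in> {a..b} \<longrightarrow> P x"
    using assms by (simp add: AE_restrict_space_iff)
  then show ?thesis
    using that by (elim AE_E3) (auto simp: negligible_iff_null_sets)
qed

lemma test_function_vanish:
  assumes "test_function a b \<eta>"
  shows "\<eta> b = 0"
  using assms by (auto simp: test_function_def)

lemma test_function_has_deriv:
  "test_function a b \<eta> \<Longrightarrow> (\<eta> has_vector_derivative deriv_on UNIV \<eta> x) (at x)"
  using smooth_on_has_deriv[of UNIV \<eta> x 0] by (simp add: test_function_def)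

lemma test_function_deriv_on:
  assumes "test_function a b \<eta>"
  shows "test_function a b (deriv_on UNIV \<eta>)"
proof -
  obtain c d where cd: "a < c" "d < b" "\<And>y. y \<notin> {c..d} \<Longrightarrow> \<eta> y = 0"
    using assms unfolding test_function_def by blast
  have "deriv_on UNIV \<eta> y = 0" if "y \<notin> {c..d}" for y
  proof -
    have "((\<lambda>_. 0) has_vector_derivative 0) (at y)" by simp
    then have "(\<eta> has_vector_derivative 0) (at y)"
      by (rule has_vector_derivative_transform_within_open[where S = "- {c..d}"])
        (use cd that in auto)
    then show ?thesis
      by (simp add: deriv_on_def vector_derivative_at)
  qed
  then show ?thesis
    using cd smooth_on_deriv assms unfolding test_function_def by blast
qed

lemma continuous_on_test_function: "test_function a b \<eta> \<Longrightarrow> continuous_on S \<eta>"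
  by (meson test_function_has_deriv continuous_at_imp_continuous_on has_vector_derivative_continuous)

lemma absolutely_integrable_test_scaleR:
  fixes f :: "real \<Rightarrow> complex"
  assumes "test_function a b \<eta>" "f absolutely_integrable_on {c..d}"
  shows "(\<lambda>x. \<eta> x *\<^sub>R f x) absolutely_integrable_on {c..d}"
  unfolding scaleR_conv_of_real
  by (intro absolutely_integrable_continuous_mult assms continuous_intros
      continuous_on_test_function[OF assms(1)])

text \<open>Translates the Lebesgue integrals of the definition into gauge integrals, for which
  primitives and integration by parts are available.\<close>

lemma weak_deriv_one_iff:
  assumes "f absolutely_integrable_on {a..b}" "g absolutely_integrable_on {a..b}"
  shows "weak_deriv a b 1 f g \<longleftrightarrow> (\<forall>\<eta>. test_function a b \<eta> \<longrightarrow>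
    integral {a..b} (\<lambda>x. deriv_on UNIV \<eta> x *\<^sub>R f x) = - integral {a..b} (\<lambda>x. \<eta> x *\<^sub>R g x))"
proof -
  have "(\<integral>x. \<eta> x *\<^sub>R h x \<partial>lebesgue_on {a..b}) = integral {a..b} (\<lambda>x. \<eta> x *\<^sub>R h x)"
    if "test_function a b \<eta>" "h absolutely_integrable_on {a..b}" for \<eta> and h :: "real \<Rightarrow> complex"
    using absolutely_integrable_test_scaleR[OF that]
    by (intro lebesgue_integral_eq_integral) (simp_all add: integrable_lebesgue_on_iff)
  then show ?thesis
    using assms test_function_deriv_on by (auto simp: weak_deriv_def)
qed

text \<open>The derivative of a test function is a test function, so it may be inserted into the
  relation of order \<open>j\<close>. This splits a weak derivative of high order into steps of
  order one.\<close>

lemma weak_deriv_chain: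
  assumes "weak_deriv a b j f g" "weak_deriv a b (Suc j) f h"
  shows "weak_deriv a b 1 g h"
  unfolding weak_deriv_def
proof (intro allI impI)
  fix \<eta> assume \<eta>: "test_function a b \<eta>"
  have "(\<integral>y. (deriv_on UNIV ^^ j) (deriv_on UNIV \<eta>) y *\<^sub>R f y \<partial>lebesgue_on {a..b}) =
        (- 1) ^ j * (\<integral>y. deriv_on UNIV \<eta> y *\<^sub>R g y \<partial>lebesgue_on {a..b})"
    using assms(1) test_function_deriv_on[OF \<eta>] unfolding weak_deriv_def by blast
  moreover have "(\<integral>y. (deriv_on UNIV ^^ Suc j) \<eta> y *\<^sub>R f y \<partial>lebesgue_on {a..b}) =
        (- 1) ^ Suc j * (\<integral>y. \<eta> y *\<^sub>R h y \<partial>lebesgue_on {a..b})"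
    using assms(2) \<eta> unfolding weak_deriv_def by blast
  ultimately have "(- 1) ^ j * (\<integral>y. deriv_on UNIV \<eta> y *\<^sub>R g y \<partial>lebesgue_on {a..b}) =
      (- 1) ^ j * - (\<integral>y. \<eta> y *\<^sub>R h y \<partial>lebesgue_on {a..b})"
    by (simp add: funpow_swap1)
  then have "(\<integral>y. deriv_on UNIV \<eta> y *\<^sub>R g y \<partial>lebesgue_on {a..b}) =
      - (\<integral>y. \<eta> y *\<^sub>R h y \<partial>lebesgue_on {a..b})"
    by (rule mult_left_cancel[THEN iffD1, rotated]) simp
  then show "(\<integral>y. (deriv_on UNIV ^^ 1) \<eta> y *\<^sub>R g y \<partial>lebesgue_on {a..b}) =
        (- 1) ^ 1 * (\<integral>y. \<eta> y *\<^sub>R h y \<partial>lebesgue_on {a..b})"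
    by simp
qed

text \<open>Integration by parts against the test function: the primitive starts at \<open>a\<close>
  and so has no boundary term there, and the one at \<open>b\<close> vanishes with the test
  function.\<close>

lemma weak_deriv_primitive:
  fixes g :: "real \<Rightarrow> complex"
  assumes "a \<le> b" "g absolutely_integrable_on {a..b}"
  shows "weak_deriv a b 1 (\<lambda>x. integral {a..x} g) g"
proof -
  have G: "continuous_on {a..b} (\<lambda>x. integral {a..x} g)"
    using assms(2) by (auto intro: indefinite_integral_continuous_1 simp: absolutely_integrable_on_def)
  show ?thesis
    unfolding weak_deriv_one_iff[OF absolutely_integrable_continuous_real[OF G] assms(2)]
  proof (intro allI impI)
    fix \<eta> assume \<eta>: "test_function a b \<eta>"
    have "((\<lambda>x. of_real (\<eta> x) * g x) has_integral of_real (\<eta> b) * integral {a..b} g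
      - integral {a..b} (\<lambda>x. of_real (deriv_on UNIV \<eta> x) * integral {a..x} g)) {a..b}"
    proof (rule has_integral_by_parts_primitive[OF assms(1) _ _ assms(2)])
      show "((\<lambda>x. of_real (\<eta> x) :: complex) has_vector_derivative of_real (deriv_on UNIV \<eta> x)) (at x within {a..b})" for x
        by (rule has_vector_derivative_at_within[OF
              has_vector_derivative_of_real[OF test_function_has_deriv[OF \<eta>,
                folded has_real_derivative_iff_has_vector_derivative]]])
      show "continuous_on {a..b} (\<lambda>x. of_real (deriv_on UNIV \<eta> x) :: complex)"
        by (intro continuous_intros continuous_on_test_function[OF test_function_deriv_on[OF \<eta>]])
    qed
    then show "integral {a..b} (\<lambda>x. deriv_on UNIV \<eta> x *\<^sub>R integral {a..x} g) = - integral {a..b} (\<lambda>x. \<eta> x *\<^sub>R g x)"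
      using test_function_vanish[OF \<eta>] by (simp add: scaleR_conv_of_real integral_unique)
  qed
qed

section \<open>The fundamental lemma: a vanishing weak derivative forces a constant\<close>

lemma cutoff_scaleR_integrable:
  fixes h :: "real \<Rightarrow> complex"
  assumes "h absolutely_integrable_on {a..b}"
  shows "(\<lambda>x. cutoff c d n x *\<^sub>R h x) integrable_on {a..b}"
proof -
  have "(\<lambda>x. of_real (cutoff c d n x) * h x) absolutely_integrable_on {a..b}"
    by (intro absolutely_integrable_continuous_mult assms continuous_intros continuous_on_cutoff)
  then show ?thesis
    by (simp add: scaleR_conv_of_real absolutely_integrable_on_def)
qed

text \<open>Dominated convergence with majorant \<open>norm (h x)\<close>. The limit is the
  indicator of the open interval, and the end points do not affect the integral.\<close>

lemma cutoff_integral_tendsto: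
  fixes h :: "real \<Rightarrow> complex"
  assumes h: "h absolutely_integrable_on {a..b}" and cd: "a \<le> c" "d \<le> b"
  shows "(\<lambda>n. integral {a..b} (\<lambda>x. cutoff c d n x *\<^sub>R h x)) \<longlonglongrightarrow> integral {c..d} h"
proof -
  have "(\<lambda>n. integral {a..b} (\<lambda>x. cutoff c d n x *\<^sub>R h x))
      \<longlonglongrightarrow> integral {a..b} (\<lambda>x. indicator {c<..<d} x *\<^sub>R h x)"
  proof (rule dominated_convergence(2))
    show "(\<lambda>x. cutoff c d n x *\<^sub>R h x) integrable_on {a..b}" for n
      by (rule cutoff_scaleR_integrable[OF h])
    show "(\<lambda>x. norm (h x)) integrable_on {a..b}"
      using h by (simp add: absolutely_integrable_on_def)
    show "norm (cutoff c d n x *\<^sub>R h x) \<le> norm (h x)" for n x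
      using cutoff_bounds[of c d n x] by (simp add: mult_left_le_one_le)
    show "(\<lambda>n. cutoff c d n x *\<^sub>R h x) \<longlonglongrightarrow> indicator {c<..<d} x *\<^sub>R h x" for x
      by (intro tendsto_scaleR cutoff_tendsto tendsto_const)
  qed
  also have "integral {a..b} (\<lambda>x. indicator {c<..<d} x *\<^sub>R h x) = integral ({c<..<d} \<inter> {a..b}) h"
    unfolding indicator_scaleR_eq_if by (rule Henstock_Kurzweil_Integration.integral_restrict_Int)
  also have "{c<..<d} \<inter> {a..b} = {c<..<d}"
    using cd by auto
  also have "integral {c<..<d} h = integral {c..d} h"
    by (rule integral_open_interval_real[symmetric])
  finally show ?thesis .
qed

lemma has_vector_derivative_quotient:
  assumes "(f has_vector_derivative D) (at x)"
  shows "((\<lambda>t. (1 / t) *\<^sub>R (f (x + t) - f x)) \<longlongrightarrow> D) (at 0)"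
proof -
  have "((\<lambda>t. norm (f (x + t) - f x - t *\<^sub>R D) / norm t) \<longlongrightarrow> 0) (at 0)"
    using assms unfolding has_vector_derivative_def has_derivative_at by blast
  moreover have "norm (f (x + t) - f x - t *\<^sub>R D) / norm t = norm ((1 / t) *\<^sub>R (f (x + t) - f x) - D)"
    if "t \<noteq> 0" for t
  proof -
    have "(1 / t) *\<^sub>R (f (x + t) - f x) - D = (1 / t) *\<^sub>R (f (x + t) - f x - t *\<^sub>R D)"
      using that by (simp add: scaleR_diff_right)
    then show ?thesis by simp
  qed
  ultimately have "((\<lambda>t. norm ((1 / t) *\<^sub>R (f (x + t) - f x) - D)) \<longlongrightarrow> 0) (at 0)"
    by (elim Lim_transform_eventually) (simp add: eventually_at_filter)
  then show ?thesis
    by (rule LIM_zero_cancel[OF tendsto_norm_zero_cancel])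
qed

text \<open>
  Testing with differences of translated cutoffs shows that the integral of \<open>h\<close> over a
  subinterval is translation invariant. At almost every point \<open>h\<close> is the limit of its
  averages, and these no longer depend on the point.
\<close>

lemma weak_deriv_0_imp_const:
  fixes h :: "real \<Rightarrow> complex"
  assumes h: "h absolutely_integrable_on {a..b}"
    and weak: "\<And>\<eta>. test_function a b \<eta> \<Longrightarrow> integral {a..b} (\<lambda>x. deriv_on UNIV \<eta> x *\<^sub>R h x) = 0"
  obtains C where "AE x in lebesgue_on {a..b}. h x = C"
proof -
  have shift: "integral {c..d} h = integral {c + s..d + s} h"
    if cd: "a < c" "c < d" "0 \<le> s" "d + s < b" for c d s
  proof -
    have "integral {a..b} (\<lambda>x. cutoff c d n x *\<^sub>R h x)
        = integral {a..b} (\<lambda>x. cutoff (c + s) (d + s) n x *\<^sub>R h x)" for n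
    proof -
      obtain \<eta> where "test_function a b \<eta>"
        "deriv_on UNIV \<eta> = (\<lambda>x. cutoff c d n x - cutoff (c + s) (d + s) n x)"
        using test_function_cutoff_diff[OF cd] .
      then have "integral {a..b} (\<lambda>x. cutoff c d n x *\<^sub>R h x - cutoff (c + s) (d + s) n x *\<^sub>R h x) = 0"
        using weak[of \<eta>] by (simp add: scaleR_diff_left)
      then show ?thesis
        using cutoff_scaleR_integrable[OF h]
        by (simp add: Henstock_Kurzweil_Integration.integral_diff)
    qed
    moreover have "(\<lambda>n. integral {a..b} (\<lambda>x. cutoff c d n x *\<^sub>R h x)) \<longlonglongrightarrow> integral {c..d} h"
      "(\<lambda>n. integral {a..b} (\<lambda>x. cutoff (c + s) (d + s) n x *\<^sub>R h x)) \<longlonglongrightarrow> integral {c + s..d + s} h"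
      by (rule cutoff_integral_tendsto[OF h]; use cd in linarith)+
    ultimately show ?thesis
      using LIMSEQ_unique by auto
  qed
  have hi: "h integrable_on {a..b}"
    using h by (simp add: absolutely_integrable_on_def)
  obtain N where N: "negligible N" "\<And>x. x \<in> {a..b} - N \<Longrightarrow>
      ((\<lambda>u. integral {a..u} h) has_vector_derivative h x) (at x within {a..b})"
    using integral_has_vector_derivative_ae[OF hi] by blast
  have avg: "((\<lambda>t. (1 / t) *\<^sub>R integral {x..x + t} h) \<longlongrightarrow> h x) (at_right 0)"
    if x: "x \<in> {a<..<b} - N" for x
  proof -
    have "((\<lambda>u. integral {a..u} h) has_vector_derivative h x) (at x)"
      using N(2)[of x] x at_within_Icc_at[of a x b] by auto
    then have "((\<lambda>t. (1 / t) *\<^sub>R (integral {a..x + t} h - integral {a..x} h)) \<longlongrightarrow> h x) (at 0)"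
      by (rule has_vector_derivative_quotient)
    then have "((\<lambda>t. (1 / t) *\<^sub>R (integral {a..x + t} h - integral {a..x} h)) \<longlongrightarrow> h x) (at_right 0)"
      by (rule filterlim_mono) (auto intro: at_le)
    moreover have "eventually (\<lambda>t. (1 / t) *\<^sub>R (integral {a..x + t} h - integral {a..x} h)
        = (1 / t) *\<^sub>R integral {x..x + t} h) (at_right 0)"
      unfolding eventually_at_right_field
    proof (intro exI[of _ "b - x"] conjI allI impI)
      show "0 < b - x" using x by auto
      fix t assume "0 < t" "t < b - x"
      then have "integral {a..x} h + integral {x..x + t} h = integral {a..x + t} h"
        using x by (intro Henstock_Kurzweil_Integration.integral_combine integrable_subinterval_real[OF hi]) auto
      then have "integral {a..x + t} h - integral {a..x} h = integral {x..x + t} h"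
        by (metis add_diff_cancel_left')
      then show "(1 / t) *\<^sub>R (integral {a..x + t} h - integral {a..x} h) = (1 / t) *\<^sub>R integral {x..x + t} h"
        by simp
    qed
    ultimately show ?thesis
      by (rule Lim_transform_eventually)
  qed
  have eq: "h x = h y" if xy: "x \<in> {a<..<b} - N" "y \<in> {a<..<b} - N" "x \<le> y" for x y
  proof (rule tendsto_unique[OF _ avg[OF xy(1)]])
    have "eventually (\<lambda>t. (1 / t) *\<^sub>R integral {y..y + t} h = (1 / t) *\<^sub>R integral {x..x + t} h) (at_right 0)"
      unfolding eventually_at_right_field
    proof (intro exI[of _ "b - y"] conjI allI impI)
      show "0 < b - y" using xy by auto
      fix t assume "0 < t" "t < b - y"
      then show "(1 / t) *\<^sub>R integral {y..y + t} h = (1 / t) *\<^sub>R integral {x..x + t} h"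
        using shift[of x "x + t" "y - x"] xy by (simp add: algebra_simps)
    qed
    then show "((\<lambda>t. (1 / t) *\<^sub>R integral {x..x + t} h) \<longlongrightarrow> h y) (at_right 0)"
      by (rule Lim_transform_eventually[OF avg[OF xy(2)]])
  qed simp
  \<comment> \<open>The value at any one point outside the exceptional set will do. If there is no
    such point, the following claim is vacuous.\<close>
  define C where "C = h (SOME x. x \<in> {a<..<b} - N)"
  have "h x = C" if "x \<in> {a..b} - (N \<union> {a, b})" for x
  proof -
    have x: "x \<in> {a<..<b} - N" using that by auto
    then have "(SOME x. x \<in> {a<..<b} - N) \<in> {a<..<b} - N" by (rule someI)
    then show ?thesis
      using eq x unfolding C_def by (metis linear)
  qed
  then have "AE x in lebesgue_on {a..b}. h x = C"
    by (intro AE_lebesgue_on_negligibleI[of "N \<union> {a, b}"]) (auto simp: N negligible_Un)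
  then show ?thesis by (rule that)
qed

text \<open>The primitive of \<open>g\<close> has the weak derivative \<open>g\<close> as well, so
  its difference from \<open>f\<close> has weak derivative 0 and is constant almost
  everywhere.\<close>

lemma weak_deriv_one_imp_primitive:
  fixes f g :: "real \<Rightarrow> complex"
  assumes ab: "a \<le> b" and f: "f absolutely_integrable_on {a..b}" and g: "g absolutely_integrable_on {a..b}"
    and weak: "weak_deriv a b 1 f g"
  obtains C where "AE x in lebesgue_on {a..b}. f x = C + integral {a..x} g"
proof -
  define G where "G x = integral {a..x} g" for x
  have "continuous_on {a..b} G"
    using g by (auto intro: indefinite_integral_continuous_1 simp: absolutely_integrable_on_def G_def[abs_def])
  then have G: "G absolutely_integrable_on {a..b}"
    by (rule absolutely_integrable_continuous_real)
  have weakG: "weak_deriv a b 1 G g"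
    using weak_deriv_primitive[OF ab g] by (simp add: G_def[abs_def])
  have "integral {a..b} (\<lambda>x. deriv_on UNIV \<eta> x *\<^sub>R (f x - G x)) = 0"
    if \<eta>: "test_function a b \<eta>" for \<eta>
  proof -
    have "(\<lambda>x. deriv_on UNIV \<eta> x *\<^sub>R f x) integrable_on {a..b}"
      "(\<lambda>x. deriv_on UNIV \<eta> x *\<^sub>R G x) integrable_on {a..b}"
      using absolutely_integrable_test_scaleR[OF test_function_deriv_on[OF \<eta>]] f G
      by (auto simp: absolutely_integrable_on_def)
    then show ?thesis
      using weak[unfolded weak_deriv_one_iff[OF f g]] weakG[unfolded weak_deriv_one_iff[OF G g]] \<eta>
      by (simp add: scaleR_diff_right Henstock_Kurzweil_Integration.integral_diff)
  qed
  then obtain C where "AE x in lebesgue_on {a..b}. f x - G x = C"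
    using weak_deriv_0_imp_const[OF set_integral_diff(1)[OF f G]] by blast
  then have "AE x in lebesgue_on {a..b}. f x = C + integral {a..x} g"
    by eventually_elim (simp add: G_def diff_eq_eq)
  then show ?thesis by (rule that)
qed

section \<open>Classical representatives of Sobolev functions\<close>

lemma integral_cong_AE_subinterval:
  fixes f g :: "real \<Rightarrow> complex"
  assumes "AE x in lebesgue_on {a..b}. f x = g x" "x \<le> b"
  shows "integral {a..x} f = integral {a..x} g"
  using assms(1)
proof (rule AE_lebesgue_on_negligibleE)
  fix N assume N: "negligible N" "\<forall>y\<in>{a..b} - N. f y = g y"
  show ?thesis
  proof (rule integral_spike[OF N(1)])
    fix y assume "y \<in> {a..x} - N"
    then have "y \<in> {a..b} - N" using assms(2) by auto
    then show "g y = f y" using N(2) by simp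
  qed
qed

text \<open>Below the top index continuity comes from differentiability. At the top index
  \<open>m\<close> it comes from the representation as an indefinite integral.\<close>

lemma continuous_on_derivative_sequence:
  fixes F :: "nat \<Rightarrow> real \<Rightarrow> complex"
  assumes "\<And>j x. j < m \<Longrightarrow> x \<in> {a..b} \<Longrightarrow> (F j has_vector_derivative F (Suc j) x) (at x within {a..b})"
    "\<And>x. x \<in> {a..b} \<Longrightarrow> F m x = C + integral {a..x} g"
    "g integrable_on {a..b}" "j \<le> m"
  shows "continuous_on {a..b} (F j)"
proof (cases "j < m")
  case True
  then show ?thesis
    using assms(1) has_vector_derivative_continuous continuous_on_eq_continuous_within by blast
next
  case False
  have "continuous_on {a..b} (\<lambda>x. C + integral {a..x} g)"
    by (intro continuous_intros indefinite_integral_continuous_1 assms(3))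
  then show ?thesis
    by (rule continuous_on_eq) (use False assms(2,4) in auto)
qed

text \<open>Induction on the length of the chain, applied to the shifted sequence: the tail provides
  a continuous representative of \<open>G 1\<close>, and integrating it yields a differentiable
  representative of \<open>G 0\<close> to be put in front.\<close>

lemma weak_deriv_sequence_classical:
  fixes G :: "nat \<Rightarrow> real \<Rightarrow> complex"
  assumes "a \<le> b" "\<And>j. j \<le> Suc m \<Longrightarrow> G j absolutely_integrable_on {a..b}"
    "\<And>j. j \<le> m \<Longrightarrow> weak_deriv a b 1 (G j) (G (Suc j))"
  shows "\<exists>F. (AE x in lebesgue_on {a..b}. F 0 x = G 0 x) \<and>
    (\<forall>j<m. \<forall>x\<in>{a..b}. (F j has_vector_derivative F (Suc j) x) (at x within {a..b})) \<and>
    (\<exists>C. \<forall>x\<in>{a..b}. F m x = C + integral {a..x} (G (Suc m)))"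
  using assms(2,3)
proof (induction m arbitrary: G)
  case 0
  obtain C where "AE x in lebesgue_on {a..b}. G 0 x = C + integral {a..x} (G 1)"
    by (rule weak_deriv_one_imp_primitive[OF assms(1), of "G 0" "G 1"]) (use 0 in auto)
  then show ?case
    by (intro exI[of _ "\<lambda>_ x. C + integral {a..x} (G 1)"]) (auto elim: eventually_mono)
next
  case (Suc m)
  have "\<exists>F. (AE x in lebesgue_on {a..b}. F 0 x = G 1 x) \<and>
    (\<forall>j<m. \<forall>x\<in>{a..b}. (F j has_vector_derivative F (Suc j) x) (at x within {a..b})) \<and>
    (\<exists>C. \<forall>x\<in>{a..b}. F m x = C + integral {a..x} (G (Suc (Suc m))))"
    using Suc.IH[of "\<lambda>j. G (Suc j)"] Suc.prems by simp
  then obtain F C where F: "AE x in lebesgue_on {a..b}. F 0 x = G 1 x"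
    "\<And>j x. j < m \<Longrightarrow> x \<in> {a..b} \<Longrightarrow> (F j has_vector_derivative F (Suc j) x) (at x within {a..b})"
    "\<And>x. x \<in> {a..b} \<Longrightarrow> F m x = C + integral {a..x} (G (Suc (Suc m)))"
    by blast
  obtain C' where C': "AE x in lebesgue_on {a..b}. G 0 x = C' + integral {a..x} (G 1)"
    by (rule weak_deriv_one_imp_primitive[OF assms(1), of "G 0" "G 1"]) (use Suc.prems in auto)
  have cont: "continuous_on {a..b} (F 0)"
    by (rule continuous_on_derivative_sequence[OF F(2,3)])
      (use Suc.prems(1)[of "Suc (Suc m)"] in \<open>auto simp: absolutely_integrable_on_def\<close>)
  \<comment> \<open>Integrating \<open>F 0\<close> rather than \<open>G 1\<close> gives the same
    values, but continuity of \<open>F 0\<close> makes the primitive differentiable at every point,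
    with derivative exactly \<open>F 0\<close>.\<close>
  define H where "H x = C' + integral {a..x} (F 0)" for x
  have H: "(H has_vector_derivative F 0 x) (at x within {a..b})" if "x \<in> {a..b}" for x
    unfolding H_def using integral_has_vector_derivative[OF cont that]
    by (auto intro!: derivative_eq_intros)
  have eq: "integral {a..x} (F 0) = integral {a..x} (G 1)" if "x \<in> {a..b}" for x
    using integral_cong_AE_subinterval[OF F(1)] that by simp
  have "AE x in lebesgue_on {a..b}. H x = G 0 x"
    using C' AE_space[of "lebesgue_on {a..b}"] by eventually_elim (simp add: H_def eq)
  then show ?case
    using F(2,3) H
    by (intro exI[of _ "case_nat H F"]) (auto split: nat.split simp: less_Suc_eq_0_disj)
qed

text \<open>On an interval of finite length the majorant 1 + |f|^2 of |f| is integrable.\<close>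

lemma square_integrable_on_imp_absolutely_integrable:
  assumes "square_integrable_on a b f"
  shows "f absolutely_integrable_on {a..b}"
proof -
  have "integrable (lebesgue_on {a..b}) f"
  proof (rule Bochner_Integration.integrable_bound)
    show "integrable (lebesgue_on {a..b}) (\<lambda>y. 1 + (cmod (f y))\<^sup>2)"
      using assms unfolding square_integrable_on_def
      by (intro Bochner_Integration.integrable_add) (auto simp: integrable_lebesgue_on_iff)
    show "f \<in> borel_measurable (lebesgue_on {a..b})"
      using assms unfolding square_integrable_on_def by blast
    have "norm (f y) \<le> 1 + (cmod (f y))\<^sup>2" for y
      using self_le_power[of "cmod (f y)" 2] power2_nonneg_ge_1_iff[of "cmod (f y)"]
      by (cases "cmod (f y) \<ge> 1") (auto intro: order_trans[of _ 1])
    then show "AE y in lebesgue_on {a..b}. norm (f y) \<le> norm (1 + (cmod (f y))\<^sup>2)"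
      by (auto intro!: AE_I2 order_trans[OF _ abs_ge_self])
  qed
  then show ?thesis by (simp add: integrable_lebesgue_on_iff)
qed

text \<open>The indefinite integral of the difference is identically 0, and by continuity its
  derivative at \<open>x\<close> recovers \<open>f x - g x\<close>.\<close>

lemma continuous_AE_eq_imp_eq:
  fixes f g :: "real \<Rightarrow> complex"
  assumes "a < b" "continuous_on {a..b} f" "continuous_on {a..b} g"
    "AE x in lebesgue_on {a..b}. f x = g x" "x \<in> {a..b}"
  shows "f x = g x"
proof -
  let ?I = "\<lambda>u. integral {a..u} (\<lambda>x. f x - g x)"
  have "?I u = 0" if "u \<in> {a..b}" for u
    using integral_cong_AE_subinterval[where f = "\<lambda>x. f x - g x" and g = "\<lambda>_. 0" and x = u] assms(4) that by simp
  then have "deriv_on {a..b} ?I x = deriv_on {a..b} (\<lambda>_. 0) x"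
    by (intro deriv_on_cong assms(5))
  also have "\<dots> = 0"
    by (rule deriv_on_eqI[OF assms(1,5)]) simp
  also have "deriv_on {a..b} ?I x = f x - g x"
    by (rule deriv_on_eqI[OF assms(1,5)])
      (intro integral_has_vector_derivative continuous_intros assms)
  finally show ?thesis by simp
qed

lemma sobolev_H_classical:
  assumes ab: "a < b" and f: "sobolev_H (Suc m) a b f"
  obtains F g C where "\<And>x. x \<in> {a..b} \<Longrightarrow> F 0 x = f x"
    "\<And>j x. j < m \<Longrightarrow> x \<in> {a..b} \<Longrightarrow> (F j has_vector_derivative F (Suc j) x) (at x within {a..b})"
    "g absolutely_integrable_on {a..b}"
    "\<And>x. x \<in> {a..b} \<Longrightarrow> F m x = C + integral {a..x} g"
proof -
  obtain G where G: "\<And>j. j \<le> Suc m \<Longrightarrow> square_integrable_on a b (G j)"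
    "\<And>j. j \<le> Suc m \<Longrightarrow> weak_deriv a b j f (G j)"
    using f unfolding sobolev_H_def by metis
  \<comment> \<open>The witness \<open>G 0\<close> for order 0 is some weak derivative of order 0,
    not literally \<open>f\<close>. Replacing it by \<open>f\<close> makes the chain start at the
    function itself.\<close>
  define G' where "G' j = (if j = 0 then f else G j)" for j
  have contf: "continuous_on {a..b} f"
    using f unfolding sobolev_H_def by blast
  have "weak_deriv a b j f (G' j)" if "j \<le> Suc m" for j
    using G(2)[OF that] by (auto simp: G'_def weak_deriv_def)
  then have "weak_deriv a b 1 (G' j) (G' (Suc j))" if "j \<le> m" for j
    using that weak_deriv_chain[of a b j f "G' j" "G' (Suc j)"] by simp
  moreover have int: "G' j absolutely_integrable_on {a..b}" if "j \<le> Suc m" for j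
    using G(1)[OF that] contf
    by (auto simp: G'_def absolutely_integrable_continuous_real square_integrable_on_imp_absolutely_integrable)
  ultimately obtain F C where F: "AE x in lebesgue_on {a..b}. F 0 x = f x"
    "\<And>j x. j < m \<Longrightarrow> x \<in> {a..b} \<Longrightarrow> (F j has_vector_derivative F (Suc j) x) (at x within {a..b})"
    "\<And>x. x \<in> {a..b} \<Longrightarrow> F m x = C + integral {a..x} (G' (Suc m))"
    using weak_deriv_sequence_classical[of a b m G'] ab by (auto simp: G'_def)
  have "continuous_on {a..b} (F 0)"
    by (rule continuous_on_derivative_sequence[OF F(2,3)])
      (use int[of "Suc m"] in \<open>auto simp: absolutely_integrable_on_def\<close>)
  then have "F 0 x = f x" if "x \<in> {a..b}" for x
    using continuous_AE_eq_imp_eq[OF ab _ contf F(1) that] by blast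
  then show ?thesis
    using that F(2,3) int[of "Suc m"] by blast
qed

section \<open>Normal modes\<close>

text \<open>The factor after \<open>cnj (F 0 x)\<close> is psi'' - k^2 psi written in terms of phi,
  with \<open>g\<close> as phi''''. After integration by parts the products of cnj phi with phi''
  and phi'''' integrate to minus the integral of |phi'|^2 and plus that of |phi''|^2, while cnj phi
  * phi is real pointwise.\<close>

lemma integral_Im_normal_mode_eq_0:
  fixes F :: "nat \<Rightarrow> real \<Rightarrow> complex" and g :: "real \<Rightarrow> complex" and \<alpha> k :: real
  assumes ab: "a < b"
    and F: "\<And>j x. j < 3 \<Longrightarrow> x \<in> {a..b} \<Longrightarrow> (F j has_vector_derivative F (Suc j) x) (at x within {a..b})"
    and g: "g absolutely_integrable_on {a..b}"
    and F3: "\<And>x. x \<in> {a..b} \<Longrightarrow> F 3 x = C + integral {a..x} g"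
    and bc: "F 0 a = 0" "F 0 b = 0" "F 2 a = 0" "F 2 b = 0"
  shows "((\<lambda>x. Im (cnj (F 0 x) * (((1 + \<alpha>\<^sup>2 * k\<^sup>2) * F 2 x - \<alpha>\<^sup>2 * g x)
      - k\<^sup>2 * ((1 + \<alpha>\<^sup>2 * k\<^sup>2) * F 0 x - \<alpha>\<^sup>2 * F 2 x)))) has_integral 0) {a..b}"
proof -
  have Im: "((\<lambda>x. Im (h x)) has_integral Im i) {a..b}" if "(h has_integral i) {a..b}" for h i
    using has_integral_linear[OF that bounded_linear_Im] by (simp add: o_def)
  have gi: "g integrable_on {a..b}"
    using g by (simp add: absolutely_integrable_on_def)
  have cont: "continuous_on {a..b} (F j)" if "j \<le> 3" for j
    by (rule continuous_on_derivative_sequence[OF F F3 gi that])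
  have F0: "(F 0 has_vector_derivative F 1 x) (at x within {a..b})"
    and F1: "(F 1 has_vector_derivative F 2 x) (at x within {a..b})"
    and F2: "(F 2 has_vector_derivative F 3 x) (at x within {a..b})" if "x \<in> {a..b}" for x
    using F[of 0 x] F[of 1 x] F[of 2 x] that by (simp_all add: eval_nat_numeral)
  have cnjF0: "((\<lambda>x. cnj (F 0 x)) has_vector_derivative cnj (F 1 x)) (at x within {a..b})"
    and cnjF1: "((\<lambda>x. cnj (F 1 x)) has_vector_derivative cnj (F 2 x)) (at x within {a..b})"
    if "x \<in> {a..b}" for x
    using F0[OF that] F1[OF that] by (auto intro: has_vector_derivative_cnj)
  have "((\<lambda>x. cnj (F 0 x) * F 2 x + cnj (F 1 x) * F 1 x) has_integral
      cnj (F 0 b) * F 1 b - cnj (F 0 a) * F 1 a) {a..b}"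
    by (rule fundamental_theorem_of_calculus[OF less_imp_le[OF ab]])
      (intro has_vector_derivative_mult cnjF0 F1)
  from Im[OF this] have I1: "((\<lambda>x. Im (cnj (F 0 x) * F 2 x)) has_integral 0) {a..b}"
    by (simp add: bc)
  \<comment> \<open>Integration by parts of cnj phi * \<open>g\<close> produces the primitive
    \<open>F 3 x - C\<close> instead of \<open>F 3 x\<close>. The correction
    \<open>C * cnj (F 1 x)\<close> integrates to 0 because phi vanishes at both ends.\<close>
  have "((\<lambda>x. (cnj (F 1 x) * F 3 x + cnj (F 2 x) * F 2 x) - C * cnj (F 1 x)) has_integral
      (cnj (F 1 b) * F 2 b - C * cnj (F 0 b)) - (cnj (F 1 a) * F 2 a - C * cnj (F 0 a))) {a..b}"
    by (rule fundamental_theorem_of_calculus[OF less_imp_le[OF ab]])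
      (intro has_vector_derivative_diff has_vector_derivative_mult has_vector_derivative_mult_right cnjF0 cnjF1 F2)
  from Im[OF this] have "((\<lambda>x. Im (cnj (F 1 x) * (F 3 x - C))) has_integral 0) {a..b}"
    by (simp add: bc algebra_simps)
  moreover have "((\<lambda>x. cnj (F 1 x) * (F 3 x - C)) has_integral
      integral {a..b} (\<lambda>x. cnj (F 1 x) * (F 3 x - C))) {a..b}"
    by (intro integrable_integral integrable_continuous_real continuous_intros cont) auto
  note Im[OF this]
  ultimately have J: "Im (integral {a..b} (\<lambda>x. cnj (F 1 x) * (F 3 x - C))) = 0"
    using has_integral_unique by blast
  have "((\<lambda>x. cnj (F 0 x) * g x) has_integral cnj (F 0 b) * integral {a..b} g
      - integral {a..b} (\<lambda>x. cnj (F 1 x) * integral {a..x} g)) {a..b}"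
    by (rule has_integral_by_parts_primitive[OF less_imp_le[OF ab] cnjF0 _ g])
      (auto intro!: continuous_intros cont)
  moreover have "integral {a..b} (\<lambda>x. cnj (F 1 x) * integral {a..x} g)
      = integral {a..b} (\<lambda>x. cnj (F 1 x) * (F 3 x - C))"
    by (rule integral_cong) (simp add: F3)
  ultimately have "((\<lambda>x. cnj (F 0 x) * g x) has_integral
      - integral {a..b} (\<lambda>x. cnj (F 1 x) * (F 3 x - C))) {a..b}"
    by (simp add: bc)
  from Im[OF this] have I2: "((\<lambda>x. Im (cnj (F 0 x) * g x)) has_integral 0) {a..b}"
    by (simp only: uminus_complex.sel J minus_zero)
  \<comment> \<open>The coefficient \<open>1 + 2 * \<alpha>\<^sup>2 * k\<^sup>2\<close> collects
    \<open>1 + \<alpha>\<^sup>2 * k\<^sup>2\<close> from psi'' and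
    \<open>\<alpha>\<^sup>2 * k\<^sup>2\<close> from -k^2 psi.\<close>
  have eq: "Im (cnj (F 0 x) * (((1 + \<alpha>\<^sup>2 * k\<^sup>2) * F 2 x - \<alpha>\<^sup>2 * g x)
      - k\<^sup>2 * ((1 + \<alpha>\<^sup>2 * k\<^sup>2) * F 0 x - \<alpha>\<^sup>2 * F 2 x)))
    = (1 + 2 * \<alpha>\<^sup>2 * k\<^sup>2) * Im (cnj (F 0 x) * F 2 x) - \<alpha>\<^sup>2 * Im (cnj (F 0 x) * g x)" for x
  proof -
    have "cnj (F 0 x) * (((1 + \<alpha>\<^sup>2 * k\<^sup>2) * F 2 x - \<alpha>\<^sup>2 * g x)
        - k\<^sup>2 * ((1 + \<alpha>\<^sup>2 * k\<^sup>2) * F 0 x - \<alpha>\<^sup>2 * F 2 x))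
      = (1 + 2 * \<alpha>\<^sup>2 * k\<^sup>2) *\<^sub>R (cnj (F 0 x) * F 2 x) - \<alpha>\<^sup>2 *\<^sub>R (cnj (F 0 x) * g x)
        - (k\<^sup>2 * (1 + \<alpha>\<^sup>2 * k\<^sup>2)) *\<^sub>R (cnj (F 0 x) * F 0 x)"
      by (simp add: scaleR_conv_of_real algebra_simps)
    moreover have "cnj (F 0 x) * F 0 x = of_real ((cmod (F 0 x))\<^sup>2)"
      by (metis complex_norm_square mult.commute)
    ultimately show ?thesis
      by (simp only: minus_complex.sel scaleR_complex.sel Im_complex_of_real mult_zero_right diff_zero)
  qed
  show ?thesis
    unfolding eq
    using has_integral_diff[OF has_integral_mult_right[OF I1] has_integral_mult_right[OF I2]] by simp
qed

section \<open>Derivatives and boundary values of a normal mode\<close>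

lemma normal_mode_has_derivative:
  fixes c :: complex
  shows
  "((\<lambda>x'. normal_mode k c f x' y t) has_vector_derivative normal_mode k c (\<lambda>y. \<i> * k * f y) x y t) (at x)"
  "((\<lambda>t'. normal_mode k c f x y t') has_vector_derivative normal_mode k c (\<lambda>y. - \<i> * k * c * f y) x y t) (at t)"
proof -
  \<comment> \<open>The exponential is differentiated as an entire function of complex
    \<open>z\<close> and then restricted to the real line.\<close>
  have "((\<lambda>z. f y * exp (\<i> * k * (z - c * t))) has_field_derivative \<i> * k * f y * exp (\<i> * k * (x - c * t)))
      (at (of_real x))"
    by (auto intro!: derivative_eq_intros)
  then show "((\<lambda>x'. normal_mode k c f x' y t) has_vector_derivative normal_mode k c (\<lambda>y. \<i> * k * f y) x y t) (at x)"
    unfolding normal_mode_def by (rule has_vector_derivative_real_field)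
  have "((\<lambda>z. f y * exp (\<i> * k * (x - c * z))) has_field_derivative - \<i> * k * c * f y * exp (\<i> * k * (x - c * t)))
      (at (of_real t))"
    by (auto intro!: derivative_eq_intros)
  then show "((\<lambda>t'. normal_mode k c f x y t') has_vector_derivative normal_mode k c (\<lambda>y. - \<i> * k * c * f y) x y t) (at t)"
    unfolding normal_mode_def by (rule has_vector_derivative_real_field)
qed

lemma dx_normal_mode:
  fixes c :: complex
  shows "dx (normal_mode k c f) = normal_mode k c (\<lambda>y. \<i> * k * f y)"
  unfolding dx_def by (intro ext vector_derivative_at normal_mode_has_derivative)

lemma dt_normal_mode:
  fixes c :: complex
  shows "dt (normal_mode k c f) = normal_mode k c (\<lambda>y. - \<i> * k * c * f y)"
  unfolding dt_def by (intro ext vector_derivative_at normal_mode_has_derivative)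

lemma dy_normal_mode:
  fixes c :: complex
  assumes "a < b" "y \<in> {a..b}" "(f has_vector_derivative D) (at y within {a..b})"
  shows "dy a b (normal_mode k c f) x y t = D * exp (\<i> * k * (x - c * t))"
  unfolding dy_def normal_mode_def
  by (intro deriv_on_eqI assms has_vector_derivative_mult_left)

text \<open>The two differentiability hypotheses differ on purpose: \<open>f'\<close> must be the
  derivative on the whole interval, but its own derivative is asked for only at \<open>y\<close>.
  For the profile psi it exists only almost everywhere.\<close>

lemma laplacian_normal_mode:
  fixes c :: complex
  assumes ab: "a < b" and f: "\<And>y. y \<in> {a..b} \<Longrightarrow> (f has_vector_derivative f' y) (at y within {a..b})"
    and y: "y \<in> {a..b}" and f': "(f' has_vector_derivative D) (at y within {a..b})"
  shows "laplacian a b (normal_mode k c f) x y t = (D - of_real (k\<^sup>2) * f y) * exp (\<i> * k * (x - c * t))"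
proof -
  have "dy a b (dy a b (normal_mode k c f)) x y t
      = deriv_on {a..b} (\<lambda>y. f' y * exp (\<i> * k * (x - c * t))) y"
    unfolding dy_def[of a b "dy a b _"]
    by (intro deriv_on_cong y dy_normal_mode ab f)
  also have "\<dots> = D * exp (\<i> * k * (x - c * t))"
    by (intro deriv_on_eqI ab y has_vector_derivative_mult_left f')
  finally have "dy a b (dy a b (normal_mode k c f)) x y t = D * exp (\<i> * k * (x - c * t))" .
  moreover have "dx (dx (normal_mode k c f)) x y t = - (k\<^sup>2 * f y) * exp (\<i> * k * (x - c * t))"
    unfolding dx_normal_mode by (simp add: normal_mode_def power2_eq_square mult_ac)
  ultimately show ?thesis
    by (simp add: laplacian_def algebra_simps)
qed

text \<open>The tangential derivative multiplies the mode by ik, which is nonzero. The tangential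
  component of the velocity is the y-derivative of the stream function, so its normal derivative is
  the second derivative of the profile up to sign. The exponential has no zero.\<close>

lemma normal_mode_boundary:
  fixes c :: complex
  assumes ab: "a < b" and k: "k \<noteq> 0" and y: "y \<in> {a, b}"
    and f: "\<And>y. y \<in> {a..b} \<Longrightarrow> (f has_vector_derivative f' y) (at y within {a..b})"
    and f': "(f' has_vector_derivative D) (at y within {a..b})"
  shows "dot (gradient a b (normal_mode k c f) x y t) tangent = 0 \<longleftrightarrow> f y = 0"
    "dot (directional a b (outer_normal a b) (\<lambda>x y t. - grad_perp a b (normal_mode k c f) x y t) x y t) tangent
       = 0 \<longleftrightarrow> D = 0"
proof -
  let ?e = "exp (\<i> * k * (x - c * t))"
  have yab: "y \<in> {a..b}" using y ab by auto
  show "dot (gradient a b (normal_mode k c f) x y t) tangent = 0 \<longleftrightarrow> f y = 0"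
    unfolding gradient_def dx_normal_mode using k by (simp add: dot_def tangent_def normal_mode_def)
  have "dy a b (\<lambda>x y t. - grad_perp a b (normal_mode k c f) x y t) x y t
      = deriv_on {a..b} (\<lambda>y. (f' y * ?e, - (\<i> * k * f y * ?e))) y"
    unfolding dy_def[of a b "\<lambda>x y t. - grad_perp a b _ x y t"]
    by (intro deriv_on_cong yab)
      (simp add: grad_perp_def dy_normal_mode[OF ab _ f] dx_normal_mode, simp add: normal_mode_def)
  also have "\<dots> = (D * ?e, - (\<i> * k * f' y * ?e))"
    by (intro deriv_on_eqI ab yab has_vector_derivative_Pair has_vector_derivative_minus
        has_vector_derivative_mult_left has_vector_derivative_mult_right f' f)
  finally show "dot (directional a b (outer_normal a b) (\<lambda>x y t. - grad_perp a b (normal_mode k c f) x y t) x y t)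
      tangent = 0 \<longleftrightarrow> D = 0"
    by (simp add: dot_def tangent_def directional_def outer_normal_def)
qed

text \<open>Fubini's theorem for null sets. One good section suffices later, since a normal mode
  depends on x only through a factor without zeros.\<close>

lemma AE_lborel_pair_section:
  fixes P :: "real \<Rightarrow> real \<Rightarrow> bool"
  assumes "AE (x, y) in lborel. P x y"
  obtains x where "AE y in lebesgue. P x y"
proof -
  have "AE z in lborel \<Otimes>\<^sub>M lborel. case z of (x, y) \<Rightarrow> P x y"
    using assms by (simp only: lborel_prod)
  then have "AE x in lborel. AE y in lborel. P x y"
    using lborel_pair.AE_pair by fastforce
  moreover have "ae_filter (lborel :: real measure) \<noteq> bot"
    by (simp add: ae_filter_eq_bot_iff)
  ultimately obtain x where "AE y in lborel. P x y"
    using eventually_happens by blast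
  then show ?thesis
    using that AE_completion by blast
qed

text \<open>Differentiating U = V - \<alpha>^2 V'' twice gives V'' - \<alpha>^2 V'''', both terms of
  which are continuous. Each application of \<open>step\<close> raises the two indices of
  \<open>W\<close> by one.\<close>

lemma continuous_on_deriv2_velocity:
  fixes V U :: "real \<Rightarrow> real"
  assumes ab: "a < b" and V: "smooth_on {a..b} V"
    and U: "\<forall>y\<in>{a..b}. U y = V y - \<alpha>\<^sup>2 * deriv_on {a..b} (deriv_on {a..b} V) y"
  shows "continuous_on {a..b} (deriv_on {a..b} (deriv_on {a..b} U))"
proof -
  define W where "W n = (deriv_on {a..b} ^^ n) V" for n
  have W: "(W n has_vector_derivative W (Suc n) y) (at y within {a..b})" if "y \<in> {a..b}" for n y
    unfolding W_def by (rule smooth_on_has_deriv[OF V that])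
  have step: "deriv_on {a..b} h y = W (Suc n) y - \<alpha>\<^sup>2 * W (Suc m) y"
    if "\<And>y. y \<in> {a..b} \<Longrightarrow> h y = W n y - \<alpha>\<^sup>2 * W m y" "y \<in> {a..b}" for h n m y
  proof -
    have "deriv_on {a..b} h y = deriv_on {a..b} (\<lambda>y. W n y - \<alpha>\<^sup>2 * W m y) y"
      using that by (intro deriv_on_cong)
    also have "\<dots> = W (Suc n) y - \<alpha>\<^sup>2 * W (Suc m) y"
      by (intro deriv_on_eqI ab that(2) has_vector_derivative_diff has_vector_derivative_mult_right W)
    finally show ?thesis .
  qed
  have "U y = W 0 y - \<alpha>\<^sup>2 * W 2 y" if "y \<in> {a..b}" for y
    using U that by (simp add: W_def numeral_2_eq_2)
  from step[OF step[OF this]]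
  have "deriv_on {a..b} (deriv_on {a..b} U) y = W 2 y - \<alpha>\<^sup>2 * W 4 y" if "y \<in> {a..b}" for y
    using that by (simp add: eval_nat_numeral)
  moreover have "continuous_on {a..b} (W n)" for n
    using W has_vector_derivative_continuous continuous_on_eq_continuous_within by blast
  then have "continuous_on {a..b} (\<lambda>y. W 2 y - \<alpha>\<^sup>2 * W 4 y)"
    by (intro continuous_intros)
  ultimately show ?thesis
    using continuous_on_eq by (metis (no_types, lifting))
qed

text \<open>All terms share the factor ik times the exponential, which cancels. The profile psi
  inherits its regularity from the relation with phi: a first derivative everywhere, a second
  wherever the primitive of \<open>g\<close> is differentiable with derivative
  \<open>g\<close>.\<close>

lemma linearized_normal_mode_equation:
  fixes F :: "nat \<Rightarrow> real \<Rightarrow> complex" and g \<phi> \<psi> :: "real \<Rightarrow> complex" and c :: complex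
    and V U :: "real \<Rightarrow> real" and \<alpha> k :: real
  assumes ab: "a < b" and k: "k \<noteq> 0"
    and F: "\<And>j x. j < 3 \<Longrightarrow> x \<in> {a..b} \<Longrightarrow> (F j has_vector_derivative F (Suc j) x) (at x within {a..b})"
    and g: "g absolutely_integrable_on {a..b}"
    and F3: "\<And>x. x \<in> {a..b} \<Longrightarrow> F 3 x = C + integral {a..x} g"
    and F0: "\<And>x. x \<in> {a..b} \<Longrightarrow> F 0 x = \<phi> x"
    and sol: "linearized_stream_solution \<alpha> a b V U (normal_mode k c \<psi>) (normal_mode k c \<phi>)"
  shows "AE y in lebesgue_on {a..b}.
      (V y - c) * (((1 + \<alpha>\<^sup>2 * k\<^sup>2) * F 2 y - \<alpha>\<^sup>2 * g y)
        - k\<^sup>2 * ((1 + \<alpha>\<^sup>2 * k\<^sup>2) * F 0 y - \<alpha>\<^sup>2 * F 2 y))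
      = deriv_on {a..b} (deriv_on {a..b} U) y * F 0 y"
    "F 0 a = 0" "F 0 b = 0" "F 2 a = 0" "F 2 b = 0"
proof -
  define \<beta> where "\<beta> = complex_of_real (1 + \<alpha>\<^sup>2 * k\<^sup>2)"
  have d\<phi>: "(\<phi> has_vector_derivative F 1 y) (at y within {a..b})" if "y \<in> {a..b}" for y
    using has_vector_derivative_transform[OF that F0[symmetric] F[of 0, OF _ that]] by simp
  have d1: "(F 1 has_vector_derivative F 2 y) (at y within {a..b})"
    and d2: "(F 2 has_vector_derivative F 3 y) (at y within {a..b})" if "y \<in> {a..b}" for y
    using F[of 1 y] F[of 2 y] that by (simp_all add: eval_nat_numeral)
  have \<psi>: "\<psi> y = \<beta> * \<phi> y - \<alpha>\<^sup>2 * F 2 y" if y: "y \<in> {a..b}" for y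
  proof -
    \<comment> \<open>At x = 0 and t = 0 the exponential equals 1, so the relation between the
      fields becomes one between the profiles.\<close>
    have "normal_mode k c \<psi> 0 y 0 = normal_mode k c \<phi> 0 y 0 - \<alpha>\<^sup>2 *\<^sub>R laplacian a b (normal_mode k c \<phi>) 0 y 0"
      using sol y unfolding linearized_stream_solution_def by blast
    moreover have "laplacian a b (normal_mode k c \<phi>) 0 y 0
        = (F 2 y - k\<^sup>2 * \<phi> y) * exp (\<i> * k * (of_real 0 - c * of_real 0))"
      by (rule laplacian_normal_mode[OF ab d\<phi> y d1[OF y]])
    ultimately have "normal_mode k c \<psi> 0 y 0 = normal_mode k c \<phi> 0 y 0
        - \<alpha>\<^sup>2 *\<^sub>R ((F 2 y - k\<^sup>2 * \<phi> y) * exp (\<i> * k * (of_real 0 - c * of_real 0)))"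
      by (simp only:)
    then show ?thesis
      by (simp add: normal_mode_def \<beta>_def scaleR_conv_of_real algebra_simps)
  qed
  define \<psi>1 where "\<psi>1 y = \<beta> * F 1 y - \<alpha>\<^sup>2 * F 3 y" for y
  have d\<psi>: "(\<psi> has_vector_derivative \<psi>1 y) (at y within {a..b})" if y: "y \<in> {a..b}" for y
  proof (rule has_vector_derivative_transform[OF y])
    show "((\<lambda>y. \<beta> * \<phi> y - \<alpha>\<^sup>2 * F 2 y) has_vector_derivative \<psi>1 y) (at y within {a..b})"
      unfolding \<psi>1_def
      by (intro has_vector_derivative_diff has_vector_derivative_mult_right d\<phi> d2 y)
  qed (simp add: \<psi>)
  have "AE (x, y) in lborel. y \<in> {a..b} \<longrightarrow>
        laplacian a b (dt (normal_mode k c \<psi>)) x y 0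
          + V y *\<^sub>R laplacian a b (dx (normal_mode k c \<psi>)) x y 0
          - deriv_on {a..b} (deriv_on {a..b} U) y *\<^sub>R dx (normal_mode k c \<phi>) x y 0 = 0"
    using sol unfolding linearized_stream_solution_def by blast
  then obtain x where "AE y in lebesgue. y \<in> {a..b} \<longrightarrow>
        laplacian a b (dt (normal_mode k c \<psi>)) x y 0
          + V y *\<^sub>R laplacian a b (dx (normal_mode k c \<psi>)) x y 0
          - deriv_on {a..b} (deriv_on {a..b} U) y *\<^sub>R dx (normal_mode k c \<phi>) x y 0 = 0"
    by (rule AE_lborel_pair_section)
  then have "AE y in lebesgue_on {a..b}.
        laplacian a b (dt (normal_mode k c \<psi>)) x y 0
          + V y *\<^sub>R laplacian a b (dx (normal_mode k c \<psi>)) x y 0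
          - deriv_on {a..b} (deriv_on {a..b} U) y *\<^sub>R dx (normal_mode k c \<phi>) x y 0 = 0"
    by (simp add: AE_restrict_space_iff)
  moreover obtain N where N: "negligible N" "\<And>y. y \<in> {a..b} - N \<Longrightarrow>
      ((\<lambda>u. integral {a..u} g) has_vector_derivative g y) (at y within {a..b})"
    using integral_has_vector_derivative_ae[of g a b] g unfolding absolutely_integrable_on_def by blast
  have "AE y in lebesgue_on {a..b}. y \<in> {a..b} - N"
    by (rule AE_lebesgue_on_negligibleI[OF N(1)])
  ultimately show "AE y in lebesgue_on {a..b}.
      (V y - c) * (((1 + \<alpha>\<^sup>2 * k\<^sup>2) * F 2 y - \<alpha>\<^sup>2 * g y)
        - k\<^sup>2 * ((1 + \<alpha>\<^sup>2 * k\<^sup>2) * F 0 y - \<alpha>\<^sup>2 * F 2 y))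
      = deriv_on {a..b} (deriv_on {a..b} U) y * F 0 y"
  proof eventually_elim
    case (elim y)
    let ?e = "exp (\<i> * k * (x - c * 0))"
    let ?L = "(\<beta> * F 2 y - \<alpha>\<^sup>2 * g y) - k\<^sup>2 * \<psi> y"
    have y: "y \<in> {a..b}" using elim by blast
    have "((\<lambda>u. C + integral {a..u} g) has_vector_derivative 0 + g y) (at y within {a..b})"
      by (intro has_vector_derivative_add has_vector_derivative_const N(2) elim(2))
    then have "(F 3 has_vector_derivative g y) (at y within {a..b})"
      using has_vector_derivative_transform[OF y F3] by simp
    then have d\<psi>1: "(\<psi>1 has_vector_derivative \<beta> * F 2 y - \<alpha>\<^sup>2 * g y) (at y within {a..b})"
      unfolding \<psi>1_def by (intro has_vector_derivative_diff has_vector_derivative_mult_right d1 y)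
    \<comment> \<open>The free scalar \<open>s\<close> serves both terms: the t-derivative
      multiplies the profile by -ikc, the x-derivative by ik.\<close>
    have lap: "laplacian a b (normal_mode k c (\<lambda>y. s * \<psi> y)) x y 0 = s * ?L * ?e" for s
      using laplacian_normal_mode[OF ab has_vector_derivative_mult_right[OF d\<psi>] y
          has_vector_derivative_mult_right[OF d\<psi>1],
          where k = k and c = c and x = x and t = 0]
      by (simp add: algebra_simps)
    have factor: "- \<i> * k * c * l * e + v * (\<i> * k * l * e) - q * (\<i> * k * r * e)
        = \<i> * k * e * ((v - c) * l - q * r)" for l e v q r :: complex
      by (simp add: algebra_simps)
    have "- \<i> * k * c * ?L * ?e + V y *\<^sub>R (\<i> * k * ?L * ?e)
        - deriv_on {a..b} (deriv_on {a..b} U) y *\<^sub>R (\<i> * k * \<phi> y * ?e) = 0"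
      using elim(1) unfolding dt_normal_mode dx_normal_mode lap by (simp add: normal_mode_def)
    then have "\<i> * k * ?e * ((V y - c) * ?L - deriv_on {a..b} (deriv_on {a..b} U) y * \<phi> y) = 0"
      unfolding scaleR_conv_of_real factor .
    then have "(V y - c) * ?L = deriv_on {a..b} (deriv_on {a..b} U) y * \<phi> y"
      using k by simp
    then show ?case
      using F0[OF y] by (simp add: \<psi>[OF y] \<beta>_def)
  qed
  have "F 0 y = 0 \<and> F 2 y = 0" if y: "y \<in> {a, b}" for y
  proof -
    have yab: "y \<in> {a..b}" using y ab by auto
    have "dot (gradient a b (normal_mode k c \<phi>) 0 y 0) tangent = 0 \<and>
      dot (directional a b (outer_normal a b) (\<lambda>x y t. - grad_perp a b (normal_mode k c \<phi>) x y t) 0 y 0) tangent = 0"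
      using sol y unfolding linearized_stream_solution_def by blast
    then show ?thesis
      using normal_mode_boundary[OF ab k y d\<phi> d1[OF yab]] F0[OF yab] by simp
  qed
  then show "F 0 a = 0" "F 0 b = 0" "F 2 a = 0" "F 2 b = 0" by auto
qed

theorem proposition3p5:
  fixes \<alpha> A1 A2 p0 k :: real and V U :: "real \<Rightarrow> real"
    and u0 v0 :: "real \<Rightarrow> real \<Rightarrow> real \<times> real" and p :: "real \<Rightarrow> real \<Rightarrow> real"
    and c :: complex and \<phi> \<psi> :: "real \<Rightarrow> complex"
  assumes "\<alpha> > 0" and "A1 < A2"
    and "smooth_on {A1..A2} V"
    and "deriv_on {A1..A2} V A1 = 0" and "deriv_on {A1..A2} V A2 = 0"
    and "\<forall>y\<in>{A1..A2}. U y = V y - \<alpha>\<^sup>2 * deriv_on {A1..A2} (deriv_on {A1..A2} V) y"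
    and "\<forall>x. \<forall>y\<in>{A1..A2}. u0 x y = (U y, 0)"
    and "\<forall>x. \<forall>y\<in>{A1..A2}. v0 x y = (V y, 0)"
    and "\<forall>x. \<forall>y\<in>{A1..A2}.
           p x y = p0 - (V y)\<^sup>2 / 2 + \<alpha>\<^sup>2 / 2 * (deriv_on {A1..A2} V y)\<^sup>2"
    and "alpha_Euler \<alpha> A1 A2 (\<lambda>x y t. u0 x y) (\<lambda>x y t. v0 x y) (\<lambda>x y t. p x y)"
    and "k \<noteq> 0" and "Im c > 0"
    and "sobolev_H 4 A1 A2 \<phi>"
    and "\<exists>y\<in>{A1..A2}. \<phi> y \<noteq> 0"
    and "linearized_stream_solution \<alpha> A1 A2 V U (normal_mode k c \<psi>) (normal_mode k c \<phi>)"
  shows "\<exists>ys\<in>{A1..A2}. deriv_on {A1..A2} (deriv_on {A1..A2} U) ys = 0"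
proof (rule ccontr)
  note ab = \<open>A1 < A2\<close>
  define Q where "Q = deriv_on {A1..A2} (deriv_on {A1..A2} U)"
  assume "\<not> ?thesis"
  then have Q0: "Q y \<noteq> 0" if "y \<in> {A1..A2}" for y
    using that by (auto simp: Q_def)
  have contQ: "continuous_on {A1..A2} Q"
    unfolding Q_def by (rule continuous_on_deriv2_velocity[OF ab assms(3,6)])
  have contV: "continuous_on {A1..A2} V"
    using assms(3) differentiable_imp_continuous_on unfolding smooth_on_def
    by (metis funpow_0)
  obtain F g C where F0: "\<And>x. x \<in> {A1..A2} \<Longrightarrow> F 0 x = \<phi> x"
    and F: "\<And>j x. j < 3 \<Longrightarrow> x \<in> {A1..A2} \<Longrightarrow> (F j has_vector_derivative F (Suc j) x) (at x within {A1..A2})"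
    and g: "g absolutely_integrable_on {A1..A2}"
    and F3: "\<And>x. x \<in> {A1..A2} \<Longrightarrow> F 3 x = C + integral {A1..x} g"
    using sobolev_H_classical[OF ab, of 3 \<phi>] assms(13) by auto
  note eqn = linearized_normal_mode_equation[OF ab \<open>k \<noteq> 0\<close> F g F3 F0 assms(15), folded Q_def]
  \<comment> \<open>This is the imaginary part of U'' |phi|^2 / (V - c), because V is real and 1 /
    (V - c) has imaginary part Im c / |V - c|^2. In contrast to the expression with \<open>g\<close>
    it is continuous.\<close>
  define R where "R y = Q y * (Im c * (cmod (F 0 y))\<^sup>2 / (cmod (V y - c))\<^sup>2)" for y
  have Vc: "complex_of_real (V y) - c \<noteq> 0" for y
    using \<open>Im c > 0\<close> by (auto simp: complex_eq_iff)
  let ?L = "\<lambda>y. ((1 + \<alpha>\<^sup>2 * k\<^sup>2) * F 2 y - \<alpha>\<^sup>2 * g y) - k\<^sup>2 * ((1 + \<alpha>\<^sup>2 * k\<^sup>2) * F 0 y - \<alpha>\<^sup>2 * F 2 y)"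
  have R: "R y = Im (cnj (F 0 y) * ?L y)" if "(V y - c) * ?L y = Q y * F 0 y" for y
  proof -
    have "?L y = Q y * F 0 y / (V y - c)"
      using that Vc[of y] by (simp add: nonzero_eq_divide_eq mult.commute)
    then have "cnj (F 0 y) * ?L y = (F 0 y * cnj (F 0 y)) * Q y / (V y - c)"
      by simp
    also have "\<dots> = of_real ((cmod (F 0 y))\<^sup>2 * Q y) / (V y - c)"
      by (simp only: complex_norm_square of_real_mult)
    finally show ?thesis
      by (simp add: R_def Im_divide cmod_power2)
  qed
  obtain N where N: "negligible N" "\<forall>y\<in>{A1..A2} - N. (V y - c) * ?L y = Q y * F 0 y"
    using AE_lebesgue_on_negligibleE[OF eqn(1)] .
  have "((\<lambda>y. Im (cnj (F 0 y) * ?L y)) has_integral 0) {A1..A2}"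
    by (rule integral_Im_normal_mode_eq_0[OF ab F g F3 eqn(2-5)])
  \<comment> \<open>The profile equation holds only off the null set \<open>N\<close>, where it
    identifies \<open>R\<close> with the integrand containing \<open>g\<close>. The values on
    \<open>N\<close> do not affect the integral.\<close>
  then have intR: "(R has_integral 0) {A1..A2}"
    by (rule has_integral_spike[OF N(1), rotated]) (rule R[OF bspec[OF N(2)]])
  have contF: "continuous_on {A1..A2} (F 0)"
    by (rule continuous_on_derivative_sequence[OF F F3])
      (use g in \<open>auto simp: absolutely_integrable_on_def\<close>)
  have contR: "continuous_on {A1..A2} R"
    unfolding R_def using Vc by (intro continuous_intros contQ contV contF) simp
  \<comment> \<open>By the intermediate value property U'' cannot change sign without a zero. The
    factor \<open>s\<close>, either 1 or -1, treats both signs at once.\<close>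
  obtain s :: real where s: "s \<noteq> 0" "\<And>y. y \<in> {A1..A2} \<Longrightarrow> 0 \<le> s * Q y"
  proof -
    have "connected (Q ` {A1..A2})"
      by (intro connected_continuous_image contQ connected_Icc)
    then have "0 \<in> Q ` {A1..A2}" if "Q y < 0" "0 < Q z" "y \<in> {A1..A2}" "z \<in> {A1..A2}" for y z
      using connectedD_interval[of "Q ` {A1..A2}" "Q y" "Q z" 0] that by auto
    then have "False" if "Q y < 0" "0 < Q z" "y \<in> {A1..A2}" "z \<in> {A1..A2}" for y z
      using that Q0 by fastforce
    then have "(\<forall>y\<in>{A1..A2}. 0 \<le> Q y) \<or> (\<forall>y\<in>{A1..A2}. Q y \<le> 0)"
      by (meson not_le)
    then show thesis using that[of 1] that[of "- 1"] by auto
  qed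
  \<comment> \<open>A continuous nonnegative function with integral 0 vanishes identically,
    including at the end points.\<close>
  have sR: "s * R y = 0" if "y \<in> {A1..A2}" for y
  proof (rule has_integral_0_cbox_imp_0[of A1 A2 "\<lambda>y. s * R y"])
    show "continuous_on (cbox A1 A2) (\<lambda>y. s * R y)"
      using contR by (auto intro: continuous_intros)
    show "0 \<le> s * R z" if "z \<in> box A1 A2" for z
    proof -
      have "0 \<le> (s * Q z) * (Im c * (cmod (F 0 z))\<^sup>2 / (cmod (V z - c))\<^sup>2)"
        using that \<open>Im c > 0\<close> by (intro mult_nonneg_nonneg[OF s(2)]) auto
      then show ?thesis by (simp add: R_def mult.assoc)
    qed
    show "((\<lambda>y. s * R y) has_integral 0) (cbox A1 A2)"
      using has_integral_mult_right[OF intR, of s] by simp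
  qed (use ab that in auto)
  \<comment> \<open>All factors of \<open>s * R y\<close> other than |phi|^2 are nonzero.\<close>
  have "\<phi> y = 0" if "y \<in> {A1..A2}" for y
    using sR[OF that] s(1) Q0[OF that] Vc[of y] \<open>Im c > 0\<close> F0[OF that] by (auto simp: R_def)
  then show False using assms(14) by blast
qed

end
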